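(* Let $X$ be an $r$-dimensional simplicial complex with $r\ge 2$, and let $q$ be a positive integer. Then $$\sum_{i=1}^{q}\lambda_{r-1,i}(X)=\sum_{i=1}^{q}d_{r-1,i}^{\top}(X)$$ if and only if $$q\ge \max\left\{\operatorname{rank}B_r(X),\ \Delta_{r-1}(X)\right\}.$$
   Context: A simplicial complex $X$ on a finite set $V$ is a collection of subsets of $V$ closed under taking subsets, with $\emptyset\in X$. A $k$-simplex is an element of $X$ of cardinality $k+1$; $X(k)$ is the set of $k$-simplices. The dimension of $X$ is the maximum dimension of its simplices; here it is $r$. Each simplex is given a fixed orientation (a linear ordering of its vertices). The boundary map $\partial_r(X)$ sends the $r$-simplex $\sigma=[v_0,\dots,v_r]$ to $\sum_{j=0}^{r}(-1)^j[v_0,\dots,\widehat{v_j},\dots,v_r]$. For $\tau\in X(r-1)$, the incidence sign $(\sigma:\tau)\in\{1,-1,0\}$ is the coefficient of the oriented simplex $\tau$ in $\partial_r(X)\sigma$: it is $1$ if $\tau\subset\sigma$ and the orientation of $\tau$ agrees with the one induced by $\sigma$, $-1$ if $\tau\subset\sigma$ and it is opposite, and $0$ if $\tau\not\subset\sigma$. $B_r(X)$ is the real matrix with rows indexed by $X(r-1)$, columns indexed by $X(r)$, and $(\tau,\sigma)$-entry $(\sigma:\tau)$. The $(r-1)$-dimensional up-Laplacian is $L_{r-1}^{\mathrm{up}}(X)=B_r(X)B_r(X)^{\top}$, a real symmetric positive semidefinite matrix indexed by $X(r-1)$. Its eigenvalues, with multiplicity and in weakly decreasing order, are $\lambda_{r-1,1}(X)\ge\lambda_{r-1,2}(X)\ge\cdots$;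 the sequence is padded with zeros beyond its length. For $\tau\in X(r-1)$, $\deg_{r-1}(X;\tau)=|\{F\in X(r):\tau\subseteq F\}|$. The conjugate $(r-1)$-degree sequence is given by $d_{r-1,j}^{\top}(X)=|\{\tau\in X(r-1):\deg_{r-1}(X;\tau)\ge j\}|$ for $j\ge1$. Finally, $\Delta_{r-1}(X)=\max_{\tau\in X(r-1)}\deg_{r-1}(X;\tau)$. *)

theory Defs
  imports
    "Jordan_Normal_Form.Char_Poly"
    "Jordan_Normal_Form.DL_Rank"
    "HOL-Combinatorics.Permutations"
begin

definition abstract_complex :: "'a set \<Rightarrow> 'a set set \<Rightarrow> bool" where
  "abstract_complex V X \<longleftrightarrow>
     finite V \<and> X \<subseteq> Pow V \<and> {} \<in> X \<and> (\<forall>\<sigma>\<in>X. \<forall>\<tau>. \<tau> \<subseteq> \<sigma> \<longrightarrow> \<tau> \<in> X)"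

definition simplices :: "'a set set \<Rightarrow> nat \<Rightarrow> 'a set set" where
  "simplices X k = {\<sigma> \<in> X. card \<sigma> = k + 1}"

text \<open>Dimensions are integers because the empty simplex has dimension \<open>-1\<close>.\<close>

definition complex_dim :: "'a set set \<Rightarrow> int" where
  "complex_dim X = Max ((\<lambda>\<sigma>. int (card \<sigma>) - 1) ` X)"

definition orientation :: "'a set set \<Rightarrow> ('a set \<Rightarrow> 'a list) \<Rightarrow> bool" where
  "orientation X ori \<longleftrightarrow> (\<forall>\<sigma>\<in>X. distinct (ori \<sigma>) \<and> set (ori \<sigma>) = \<sigma>)"

text \<open>For duplicate-free lists, \<open>rel_sign xs ys\<close> is the coefficient of the oriented simplex
  \<open>ys\<close> in the oriented simplex \<open>xs\<close>: the two agree up to the sign of the permutation relating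
  them, which is then unique, and the coefficient is \<open>0\<close> if their vertex sets differ.\<close>

definition rel_sign :: "'a list \<Rightarrow> 'a list \<Rightarrow> int" where
  "rel_sign xs ys =
     (if \<exists>p. p permutes {..<length xs} \<and> permute_list p xs = ys
      then sign (SOME p. p permutes {..<length xs} \<and> permute_list p xs = ys)
      else 0)"

text \<open>The coefficient of \<open>\<tau>\<close> in the boundary
  \<open>\<Sum>j. (-1)^j [v\<^sub>0, \<dots>, v\<^sub>j omitted, \<dots>, v\<^sub>r]\<close> of \<open>\<sigma>\<close>.\<close>

definition incidence :: "('a set \<Rightarrow> 'a list) \<Rightarrow> 'a set \<Rightarrow> 'a set \<Rightarrow> int" where
  "incidence ori \<sigma> \<tau> =
     (\<Sum>j<length (ori \<sigma>).
        (- 1) ^ j * rel_sign (take j (ori \<sigma>) @ drop (Suc j) (ori \<sigma>)) (ori \<tau>))"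

text \<open>Matrices are indexed by natural numbers, so the simplices indexing rows and columns are
  listed without repetition, in an arbitrary order.\<close>

definition enumerates :: "'b list \<Rightarrow> 'b set \<Rightarrow> bool" where
  "enumerates xs A \<longleftrightarrow> distinct xs \<and> set xs = A"

definition boundary_mat ::
  "('a set \<Rightarrow> 'a list) \<Rightarrow> 'a set list \<Rightarrow> 'a set list \<Rightarrow> real mat" where
  "boundary_mat ori rs cs =
     mat (length rs) (length cs) (\<lambda>(i, j). of_int (incidence ori (cs ! j) (rs ! i)))"

definition up_laplacian ::
  "('a set \<Rightarrow> 'a list) \<Rightarrow> 'a set list \<Rightarrow> 'a set list \<Rightarrow> real mat" where
  "up_laplacian ori rs cs =
     boundary_mat ori rs cs * transpose_mat (boundary_mat ori rs cs)"

definition mat_rank :: "real mat \<Rightarrow> nat" where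
  "mat_rank A = vec_space.rank (dim_row A) A"

text \<open>The real eigenvalues with multiplicity in weakly decreasing order, which for a symmetric
  matrix are all the eigenvalues. Indices start at \<open>1\<close>; the sequence is padded with zeros.\<close>

definition eigval_list :: "real mat \<Rightarrow> real list" where
  "eigval_list A = rev (sorted_list_of_multiset (proots (char_poly A)))"

definition eigval :: "real mat \<Rightarrow> nat \<Rightarrow> real" where
  "eigval A i =
     (if 1 \<le> i \<and> i \<le> length (eigval_list A) then eigval_list A ! (i - 1) else 0)"

definition simplex_degree :: "'a set set \<Rightarrow> nat \<Rightarrow> 'a set \<Rightarrow> nat" where
  "simplex_degree X k \<tau> = card {F \<in> simplices X (k + 1). \<tau> \<subseteq> F}"

definition conj_degree :: "'a set set \<Rightarrow> nat \<Rightarrow> nat \<Rightarrow> nat" where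
  "conj_degree X k j = card {\<tau> \<in> simplices X k. simplex_degree X k \<tau> \<ge> j}"

definition max_degree :: "'a set set \<Rightarrow> nat \<Rightarrow> nat" where
  "max_degree X k = Max (simplex_degree X k ` simplices X k)"

end

theory Submission
  imports Defs "HOL-Analysis.Function_Topology"
begin

text \<open>
  Write \<open>B\<close> for the boundary matrix, \<open>b\<^sub>F\<close> for its column at an \<open>r\<close>-simplex \<open>F\<close>, and \<open>d(\<tau>)\<close> for the
  degree of an \<open>(r - 1)\<close>-simplex \<open>\<tau>\<close>. Counting the incidences level by level, the sum of the first
  \<open>q\<close> conjugate degrees is \<open>\<Sum>\<tau>. min (d \<tau>) q\<close>. Let \<open>\<Delta>\<close> be the largest degree.

  If \<open>\<Delta> \<le> q\<close>, this is the sum of all degrees, which is the trace of \<open>B B\<^sup>T\<close>. The eigenvalues of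
  \<open>B B\<^sup>T\<close> are nonnegative and exactly \<open>rank B\<close> of them are nonzero, so the first \<open>q\<close> of them sum up
  to the trace if and only if \<open>rank B \<le> q\<close> (\<open>sum_first_eigvals_eq_trace_iff\<close>).

  If \<open>q < \<Delta>\<close>, equality must fail, and in fact the eigenvalue sum is strictly smaller
  (\<open>frame_sum_less\<close>). It is \<open>\<Sum>F. y F\<close>, where \<open>y F\<close> is the squared length of the projection of
  \<open>b\<^sub>F\<close> onto the span of the first \<open>q\<close> eigenvectors; the argument works for every \<open>q\<close>-dimensional
  space in place of that span. For \<open>r \<ge> 2\<close> the problem localises at the \<open>(r - 2)\<close>-simplices \<open>\<eta>\<close>:
  it suffices that \<open>2 * (\<Sum>F\<supseteq>\<eta>. y F) \<le> (r + 1) * (\<Sum>\<tau>\<supseteq>\<eta>. min (d \<tau>) q)\<close>, with strict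
  inequality as soon as some \<open>\<tau> \<supseteq> \<eta>\<close> has degree above \<open>q\<close> (\<open>codim2_bound\<close>). Summing over
  \<open>\<eta>\<close> counts every \<open>F\<close> with multiplicity \<open>(r + 1) r / 2\<close> and every \<open>\<tau>\<close> with multiplicity \<open>r\<close>,
  and gives \<open>\<Sum>F. y F < \<Sum>\<tau>. min (d \<tau>) q\<close>.

  The simplices around \<open>\<eta>\<close> form the link graph of \<open>\<eta>\<close>, with the \<open>\<tau> \<supseteq> \<eta>\<close> as vertices, the
  \<open>F \<supseteq> \<eta>\<close> as edges, and \<open>d\<close> as the vertex degree. Since the boundary of a boundary vanishes, the
  signs can be normalised so that the two \<open>\<tau>\<close> below an \<open>F\<close> contribute the ordinary graph Laplacian. The
  other \<open>r - 1\<close> facets of \<open>F\<close> lie in no other \<open>F' \<supseteq> \<eta>\<close>, so they only add \<open>r - 1\<close> times the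
  identity. Hence a bound on partial sums of graph Laplacian eigenvalues is needed. The
  Grone--Merris bound by \<open>m = \<Sum>\<tau>. min (d \<tau>) q\<close> would be more than enough: because of the identity
  part, the weaker bound \<open>3 m / 2 - q\<close> suffices, and it has an elementary proof
  (\<open>weak_grone_merris\<close>). Here \<open>r \<ge> 2\<close> matters: for \<open>r = 1\<close> there is no identity part to exploit,
  and for a complete graph the eigenvalue sum and the degree sum agree for every \<open>q\<close>.
\<close>

section \<open>Orthonormal frames on a finite index set\<close>

text \<open>Vectors are functions restricted to a finite index set and a subspace is given by an
  orthonormal frame. The same lemmas then apply to matrices with rows in one set of simplices and
  columns in another, and to the submatrices around a fixed simplex.\<close>

definition orthonormal_on :: "'b set \<Rightarrow> nat \<Rightarrow> (nat \<Rightarrow> 'b \<Rightarrow> real) \<Rightarrow> bool" where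
  "orthonormal_on I k u \<longleftrightarrow> (\<forall>i<k. \<forall>j<k. (\<Sum>x\<in>I. u i x * u j x) = of_bool (i = j))"

lemma orthonormal_onD:
  "orthonormal_on I k u \<Longrightarrow> i < k \<Longrightarrow> j < k \<Longrightarrow> (\<Sum>x\<in>I. u i x * u j x) = of_bool (i = j)"
  by (simp add: orthonormal_on_def)

lemma orthonormal_on_norm:
  assumes "orthonormal_on I k u"
  shows "(\<Sum>x\<in>I. (\<Sum>i<k. c i * u i x)\<^sup>2) = (\<Sum>i<k. (c i)\<^sup>2)"
proof -
  have "(\<Sum>x\<in>I. (\<Sum>i<k. c i * u i x)\<^sup>2) = (\<Sum>x\<in>I. \<Sum>i<k. \<Sum>j<k. c i * c j * (u i x * u j x))"
    by (simp add: power2_eq_square sum_product mult_ac)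
  also have "\<dots> = (\<Sum>i<k. \<Sum>x\<in>I. \<Sum>j<k. c i * c j * (u i x * u j x))"
    by (rule sum.swap)
  also have "\<dots> = (\<Sum>i<k. \<Sum>j<k. \<Sum>x\<in>I. c i * c j * (u i x * u j x))"
    by (intro sum.cong refl sum.swap)
  also have "\<dots> = (\<Sum>i<k. \<Sum>j<k. c i * c j * of_bool (i = j))"
    using assms by (simp add: sum_distrib_left[symmetric] orthonormal_on_def)
  also have "\<dots> = (\<Sum>i<k. (c i)\<^sup>2)"
    by (intro sum.cong refl) (simp add: of_bool_def if_distrib power2_eq_square cong: if_cong)
  finally show ?thesis .
qed

lemma sum_swap_inner:
  fixes c :: "nat \<Rightarrow> real"
  shows "(\<Sum>x\<in>I. f x * (\<Sum>i<k. c i * u i x)) = (\<Sum>i<k. c i * (\<Sum>x\<in>I. f x * u i x))"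
proof -
  have "(\<Sum>x\<in>I. f x * (\<Sum>i<k. c i * u i x)) = (\<Sum>x\<in>I. \<Sum>i<k. c i * (f x * u i x))"
    by (simp add: sum_distrib_left mult_ac)
  also have "\<dots> = (\<Sum>i<k. \<Sum>x\<in>I. c i * (f x * u i x))" by (rule sum.swap)
  finally show ?thesis by (simp add: sum_distrib_left)
qed

lemma orthonormal_residual:
  assumes "orthonormal_on I k u"
  defines "c \<equiv> (\<lambda>f i. \<Sum>x\<in>I. f x * u i x)"
  shows "(\<Sum>x\<in>I. (f x - (\<Sum>i<k. c f i * u i x))\<^sup>2) = (\<Sum>x\<in>I. (f x)\<^sup>2) - (\<Sum>i<k. (c f i)\<^sup>2)"
proof -
  have "(\<Sum>x\<in>I. (f x - (\<Sum>i<k. c f i * u i x))\<^sup>2) =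
     (\<Sum>x\<in>I. (f x)\<^sup>2) + (\<Sum>x\<in>I. (\<Sum>i<k. c f i * u i x)\<^sup>2) - 2 * (\<Sum>x\<in>I. f x * (\<Sum>i<k. c f i * u i x))"
    by (simp add: power2_diff sum.distrib sum_subtractf sum_distrib_left mult_ac)
  also have "(\<Sum>x\<in>I. f x * (\<Sum>i<k. c f i * u i x)) = (\<Sum>i<k. (c f i)\<^sup>2)"
    unfolding sum_swap_inner by (simp add: c_def power2_eq_square)
  finally show ?thesis using orthonormal_on_norm[OF assms(1)] by simp
qed

lemma bessel:
  assumes "orthonormal_on I k u"
  shows "(\<Sum>i<k. (\<Sum>x\<in>I. f x * u i x)\<^sup>2) \<le> (\<Sum>x\<in>I. (f x)\<^sup>2)"
proof -
  have "0 \<le> (\<Sum>x\<in>I. (f x - (\<Sum>i<k. (\<Sum>y\<in>I. f y * u i y) * u i x))\<^sup>2)"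
    by (intro sum_nonneg) simp
  then show ?thesis using orthonormal_residual[OF assms, of f] by simp
qed

lemma residual_orthogonal:
  assumes "orthonormal_on I k u" "j < k"
  shows "(\<Sum>x\<in>I. (f x - (\<Sum>i<k. (\<Sum>y\<in>I. f y * u i y) * u i x)) * u j x) = 0"
proof -
  have "(\<Sum>x\<in>I. (f x - (\<Sum>i<k. (\<Sum>y\<in>I. f y * u i y) * u i x)) * u j x)
      = (\<Sum>x\<in>I. f x * u j x) - (\<Sum>x\<in>I. u j x * (\<Sum>i<k. (\<Sum>y\<in>I. f y * u i y) * u i x))"
    by (simp add: algebra_simps sum_subtractf)
  also have "(\<Sum>x\<in>I. u j x * (\<Sum>i<k. (\<Sum>y\<in>I. f y * u i y) * u i x))
      = (\<Sum>i<k. (\<Sum>y\<in>I. f y * u i y) * of_bool (j = i))"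
    unfolding sum_swap_inner using assms by (simp add: orthonormal_on_def)
  also have "\<dots> = (\<Sum>y\<in>I. f y * u j y)"
    using assms(2) by (simp add: of_bool_def if_distrib cong: if_cong)
  finally show ?thesis by simp
qed

lemma orthonormal_on_snoc:
  assumes "orthonormal_on I k u" "(\<Sum>x\<in>I. (w x)\<^sup>2) = 1"
    and "\<And>j. j < k \<Longrightarrow> (\<Sum>x\<in>I. w x * u j x) = 0"
  shows "orthonormal_on I (Suc k) (u(k := w))"
  using assms unfolding orthonormal_on_def
  by (auto simp: less_Suc_eq power2_eq_square mult.commute)

lemma normalize_on:
  fixes g :: "'b \<Rightarrow> real"
  assumes "(\<Sum>x\<in>I. (g x)\<^sup>2) \<noteq> 0"
  obtains c where "c \<noteq> 0" "(\<Sum>x\<in>I. (g x / c)\<^sup>2) = 1"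
proof
  let ?s = "\<Sum>x\<in>I. (g x)\<^sup>2"
  have pos: "?s > 0" using assms sum_nonneg[of I "\<lambda>x. (g x)\<^sup>2"] by auto
  show "sqrt ?s \<noteq> 0" using pos by simp
  show "(\<Sum>x\<in>I. (g x / sqrt ?s)\<^sup>2) = 1"
    using pos by (simp add: power_divide sum_divide_distrib[symmetric])
qed

lemma gram_schmidt_on:
  fixes z :: "nat \<Rightarrow> 'b \<Rightarrow> real"
  assumes fin: "finite I"
  shows "\<exists>k v. k \<le> m \<and> orthonormal_on I k v \<and>
    (\<forall>i<m. \<forall>x\<in>I. z i x = (\<Sum>j<k. (\<Sum>y\<in>I. z i y * v j y) * v j x))"
proof (induction m)
  case 0
  then show ?case by (intro exI[of _ 0]) (simp add: orthonormal_on_def)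
next
  case (Suc m)
  then obtain k v where k: "k \<le> m" and on: "orthonormal_on I k v"
    and sp: "\<And>i x. i < m \<Longrightarrow> x \<in> I \<Longrightarrow> z i x = (\<Sum>j<k. (\<Sum>y\<in>I. z i y * v j y) * v j x)" by blast
  define g where "g x = z m x - (\<Sum>j<k. (\<Sum>y\<in>I. z m y * v j y) * v j x)" for x
  show ?case
  proof (cases "(\<Sum>x\<in>I. (g x)\<^sup>2) = 0")
    case True
    then have g0: "\<forall>x\<in>I. g x = 0" using fin by (subst (asm) sum_nonneg_eq_0_iff) auto
    have zm: "z m x = (\<Sum>j<k. (\<Sum>y\<in>I. z m y * v j y) * v j x)" if "x \<in> I" for x
    proof -
      have "g x = 0" using g0 that by blast
      then show ?thesis unfolding g_def by (rule eq_iff_diff_eq_0[THEN iffD2])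
    qed
    have "z i x = (\<Sum>j<k. (\<Sum>y\<in>I. z i y * v j y) * v j x)" if "i < Suc m" "x \<in> I" for i x
    proof (cases "i = m")
      case True
      with zm that show ?thesis by blast
    next
      case False
      with that show ?thesis by (intro sp) auto
    qed
    then show ?thesis using k on le_SucI by blast
  next
    case False
    then obtain c where c: "c \<noteq> 0" "(\<Sum>x\<in>I. (g x / c)\<^sup>2) = 1" by (rule normalize_on)
    define w where "w x = g x / c" for x
    have orth: "(\<Sum>x\<in>I. w x * v j x) = 0" if "j < k" for j
      using residual_orthogonal[OF on that, of "z m"]
      by (simp add: w_def g_def sum_divide_distrib[symmetric])
    have on': "orthonormal_on I (Suc k) (v(k := w))"
      using orthonormal_on_snoc[OF on _ orth] c unfolding w_def by blast
    have zw: "(\<Sum>y\<in>I. z i y * w y) = 0" if "i < m" for i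
    proof -
      have "(\<Sum>y\<in>I. z i y * w y) = (\<Sum>y\<in>I. w y * (\<Sum>j<k. (\<Sum>y\<in>I. z i y * v j y) * v j y))"
        using sp[OF that] by (intro sum.cong refl) (metis mult.commute)
      also have "\<dots> = 0" unfolding sum_swap_inner using orth by simp
      finally show ?thesis .
    qed
    have zm: "z m x = (\<Sum>j<k. (\<Sum>y\<in>I. z m y * v j y) * v j x) + c * w x" for x
      using c by (simp add: w_def g_def)
    have "(\<Sum>y\<in>I. z m y * w y) = (\<Sum>y\<in>I. w y * (\<Sum>j<k. (\<Sum>y\<in>I. z m y * v j y) * v j y)) + c * (\<Sum>y\<in>I. (w y)\<^sup>2)"
      by (subst zm) (simp only: algebra_simps sum.distrib sum_distrib_left power2_eq_square)
    also have "\<dots> = c" unfolding sum_swap_inner using orth c by (simp add: w_def)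
    finally have zmw: "(\<Sum>y\<in>I. z m y * w y) = c" .
    have "(\<Sum>j<Suc k. (\<Sum>y\<in>I. z m y * (v(k := w)) j y) * (v(k := w)) j x)
        = (\<Sum>j<k. (\<Sum>y\<in>I. z m y * v j y) * v j x) + c * w x" for x
      using zmw by simp
    then have "z m x = (\<Sum>j<Suc k. (\<Sum>y\<in>I. z m y * (v(k := w)) j y) * (v(k := w)) j x)" for x
      using zm[of x] by (rule trans[OF _ sym, rotated])
    moreover have "z i x = (\<Sum>j<Suc k. (\<Sum>y\<in>I. z i y * (v(k := w)) j y) * (v(k := w)) j x)"
      if "i < m" "x \<in> I" for i x
    proof -
      have "(\<Sum>j<Suc k. (\<Sum>y\<in>I. z i y * (v(k := w)) j y) * (v(k := w)) j x)
        = (\<Sum>j<k. (\<Sum>y\<in>I. z i y * v j y) * v j x)"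
        using zw[OF that(1)] by simp
      then show ?thesis using sp[OF that] by (rule trans[OF _ sym, rotated])
    qed
    ultimately have "z i x = (\<Sum>j<Suc k. (\<Sum>y\<in>I. z i y * (v(k := w)) j y) * (v(k := w)) j x)"
      if "i < Suc m" "x \<in> I" for i x
      using that less_Suc_eq by blast
    then show ?thesis using k on' Suc_le_mono by blast
  qed
qed

text \<open>For a projection \<open>P\<close> of rank \<open>k\<close> this compares \<open>tr (P b b\<^sup>T)\<close> with \<open>tr (Q b\<^sup>T b)\<close> for a projection
  \<open>Q\<close> of rank at most \<open>k\<close> on the other side, and replaces the fact that \<open>b b\<^sup>T\<close> and \<open>b\<^sup>T b\<close> have the
  same nonzero eigenvalues. One takes \<open>Q\<close> to be the projection onto the row space of \<open>P b\<close>; then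
  \<open>P b = P b Q\<close>, and dropping \<open>P\<close> on the right can only increase the norm.\<close>

lemma frame_transfer:
  fixes b :: "'b \<Rightarrow> 'c \<Rightarrow> real"
  assumes "finite J" and u: "orthonormal_on I k u"
  obtains l v where "l \<le> k" "orthonormal_on J l v"
    "(\<Sum>i<k. \<Sum>y\<in>J. (\<Sum>x\<in>I. b x y * u i x)\<^sup>2) \<le> (\<Sum>j<l. \<Sum>x\<in>I. (\<Sum>y\<in>J. b x y * v j y)\<^sup>2)"
proof -
  define z where "z i y = (\<Sum>x\<in>I. b x y * u i x)" for i y
  obtain l v where l: "l \<le> k" and v: "orthonormal_on J l v"
    and sp: "\<And>i y. i < k \<Longrightarrow> y \<in> J \<Longrightarrow> z i y = (\<Sum>j<l. (\<Sum>y\<in>J. z i y * v j y) * v j y)"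
    using gram_schmidt_on[OF assms(1), of k z] by blast
  have "(\<Sum>i<k. \<Sum>y\<in>J. (z i y)\<^sup>2) = (\<Sum>i<k. \<Sum>j<l. (\<Sum>y\<in>J. z i y * v j y)\<^sup>2)"
  proof (intro sum.cong refl)
    fix i assume "i \<in> {..<k}"
    then have "(\<Sum>y\<in>J. (z i y)\<^sup>2) = (\<Sum>y\<in>J. (\<Sum>j<l. (\<Sum>y\<in>J. z i y * v j y) * v j y)\<^sup>2)"
      by (intro sum.cong[OF refl] arg_cong[where f = "\<lambda>t. t\<^sup>2"] sp) auto
    then show "(\<Sum>y\<in>J. (z i y)\<^sup>2) = (\<Sum>j<l. (\<Sum>y\<in>J. z i y * v j y)\<^sup>2)"
      using orthonormal_on_norm[OF v] by simp
  qed
  also have "\<dots> = (\<Sum>j<l. \<Sum>i<k. (\<Sum>y\<in>J. z i y * v j y)\<^sup>2)" by (rule sum.swap)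
  also have "\<dots> = (\<Sum>j<l. \<Sum>i<k. (\<Sum>x\<in>I. (\<Sum>y\<in>J. b x y * v j y) * u i x)\<^sup>2)"
  proof (intro sum.cong refl arg_cong[where f = "\<lambda>t. t\<^sup>2"])
    fix i j
    show "(\<Sum>y\<in>J. z i y * v j y) = (\<Sum>x\<in>I. (\<Sum>y\<in>J. b x y * v j y) * u i x)"
      unfolding z_def sum_distrib_right by (subst sum.swap) (simp add: mult_ac)
  qed
  also have "\<dots> \<le> (\<Sum>j<l. \<Sum>x\<in>I. (\<Sum>y\<in>J. b x y * v j y)\<^sup>2)"
    by (intro sum_mono bessel[OF u])
  finally show thesis using that[OF l v] by (simp add: z_def)
qed

section \<open>A weak Grone--Merris inequality for graphs\<close>

text \<open>This is the arithmetic-geometric mean inequality applied to Cauchy--Schwarz,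
  \<open>2 |\<Sum>p| \<le> 2 sqrt (card N (1 - a)) sqrt a\<close>. It will be used for the row of a projection matrix at
  the centre of a star, whose diagonal entry is \<open>a\<close> and whose other entries have squares summing up
  to \<open>a - a\<^sup>2\<close>.\<close>

lemma star_cross_term:
  fixes p :: "'v \<Rightarrow> real" and a :: real
  assumes "finite N" "0 \<le> a" "a \<le> 1" and sq: "(\<Sum>t\<in>N. (p t)\<^sup>2) \<le> a - a\<^sup>2"
  shows "- 2 * (\<Sum>t\<in>N. p t) \<le> real (card N) * (1 - a) + a"
proof (cases "a = 1")
  case True
  then have "(\<Sum>t\<in>N. (p t)\<^sup>2) \<le> 0" using sq by simp
  then have "(\<Sum>t\<in>N. (p t)\<^sup>2) = 0" by (meson antisym sum_nonneg zero_le_power2)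
  then have "\<forall>t\<in>N. p t = 0" using assms(1) by (subst (asm) sum_nonneg_eq_0_iff) auto
  then show ?thesis using True by simp
next
  case False
  then have pos: "1 - a > 0" using assms by simp
  have "- 2 * p t \<le> (1 - a) + (p t)\<^sup>2 / (1 - a)" for t
  proof -
    have "0 \<le> ((1 - a) + p t)\<^sup>2 / (1 - a)" using pos by simp
    also have "\<dots> = (1 - a) + 2 * p t + (p t)\<^sup>2 / (1 - a)"
      using pos by (simp add: field_simps power2_eq_square)
    finally show ?thesis by simp
  qed
  then have "(\<Sum>t\<in>N. - 2 * p t) \<le> (\<Sum>t\<in>N. (1 - a) + (p t)\<^sup>2 / (1 - a))"
    by (intro sum_mono)
  also have "\<dots> = real (card N) * (1 - a) + (\<Sum>t\<in>N. (p t)\<^sup>2) / (1 - a)"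
    by (simp add: sum.distrib sum_divide_distrib)
  also have "(\<Sum>t\<in>N. (p t)\<^sup>2) / (1 - a) \<le> (a - a\<^sup>2) / (1 - a)"
    using sq pos by (simp add: divide_right_mono)
  also have "(a - a\<^sup>2) / (1 - a) = a" using pos by (simp add: field_simps power2_eq_square)
  finally show ?thesis by (simp add: sum_distrib_left sum_negf)
qed

text \<open>
  The sum over ordered adjacent pairs is twice the trace of the graph Laplacian on the span of \<open>w\<close>.
  Let \<open>P\<close> be the projection onto that span, \<open>a\<close> its diagonal, \<open>S\<close> the set of vertices of degree above
  \<open>q\<close> with \<open>s\<close> elements, \<open>T\<close> the remaining vertices, \<open>E\<close> the number of edges between \<open>S\<close> and \<open>T\<close>, and
  \<open>\<alpha>\<close> and \<open>\<beta>\<close> the masses of \<open>a\<close> on \<open>S\<close> and \<open>T\<close>, so that \<open>\<alpha> + \<beta> \<le> q\<close>. Three estimates are added.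
  \<^item> Edges inside \<open>S\<close> contribute at most \<open>s \<alpha>\<close>, as the Laplacian of a complete graph on \<open>s\<close> vertices
    is at most \<open>s\<close>; for \<open>s = 1\<close> there are none.
  \<^item> The edges between \<open>S\<close> and \<open>T\<close> form stars centred in \<open>S\<close>. They contribute at most \<open>E + \<alpha> + s \<beta>\<close>,
    by \<open>star_cross_term\<close> for every centre.
  \<^item> An edge inside \<open>T\<close> contributes at most 2, and it also adds 2 to \<open>m\<close>.

  As \<open>m\<close> is \<open>s q + E\<close> plus twice the number of edges inside \<open>T\<close>, the trace is at most \<open>m + \<alpha>\<close>, which is
  within \<open>q\<close> of the Grone--Merris bound. The error \<open>\<alpha>\<close> is absent if \<open>s = 1\<close> or \<open>E = 0\<close>, and then
  \<open>2 q < m\<close> is enough; otherwise it is absorbed because \<open>m \<ge> 4 q\<close>.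
\<close>

lemma weak_grone_merris:
  fixes V :: "'v set" and adj :: "'v \<Rightarrow> 'v \<Rightarrow> bool" and w :: "nat \<Rightarrow> 'v \<Rightarrow> real"
  assumes fin: "finite V" and sym: "\<And>x y. adj x y \<Longrightarrow> adj y x" and irr: "\<And>x. \<not> adj x x"
    and on: "orthonormal_on V k w" and kq: "k \<le> q" and q: "1 \<le> q"
    and v0: "v0 \<in> V" "q < card {t \<in> V. adj v0 t}"
  defines "m \<equiv> (\<Sum>v\<in>V. min (card {t \<in> V. adj v t}) q)"
  shows "(\<Sum>i<k. \<Sum>v\<in>V. \<Sum>t | t \<in> V \<and> adj v t. (w i v - w i t)\<^sup>2) < 3 * real m - 2 * real q"
    and "2 * q < m"
proof -
  define N where "N v = {t \<in> V. adj v t}" for v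
  define P where "P v t = (\<Sum>i<k. w i v * w i t)" for v t
  define a where "a v = P v v" for v
  define D where "D v t = (\<Sum>i<k. (w i v - w i t)\<^sup>2)" for v t
  define S where "S = {v \<in> V. q < card (N v)}"
  define T where "T = V - S"
  define e where "e v = card (N v \<inter> T)" for v
  define E where "E = (\<Sum>v\<in>S. e v)"
  define c where "c = (\<Sum>v\<in>T. card (N v \<inter> T))"
  define s where "s = card S"
  define \<alpha> where "\<alpha> = (\<Sum>v\<in>S. a v)"
  define \<beta> where "\<beta> = (\<Sum>v\<in>T. a v)"
  have fN: "finite (N v)" for v using fin by (simp add: N_def)
  have ST: "S \<subseteq> V" "T \<subseteq> V" "S \<union> T = V" "S \<inter> T = {}" "finite S" "finite T"
    using fin by (auto simp: S_def T_def)
  have NV: "N v = (N v \<inter> S) \<union> (N v \<inter> T)" for v using ST by (auto simp: N_def)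
  have v0S: "v0 \<in> S" using v0 by (simp add: S_def N_def)
  have cardN: "card (N v) = card (N v \<inter> S) + card (N v \<inter> T)" for v
    using fN ST by (subst NV, subst card_Un_disjoint) auto

  have D_eq: "D v t = a v + a t - 2 * P v t" for v t
    by (simp add: D_def a_def P_def power2_eq_square algebra_simps sum.distrib sum_subtractf sum_distrib_left)
  have D_sym: "D v t = D t v" for v t by (simp add: D_def power2_commute)
  \<comment> \<open>The diagonal of \<open>P P\<^sup>T = P\<close>.\<close>
  have idem: "(\<Sum>t\<in>V. (P v t)\<^sup>2) = a v" for v
    using orthonormal_on_norm[OF on, of "\<lambda>i. w i v"] by (simp add: P_def a_def power2_eq_square)
  have a_ge: "0 \<le> a v" for v by (simp add: a_def P_def sum_nonneg)
  have a_le: "a v \<le> 1" if "v \<in> V" for v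
  proof -
    have "(a v)\<^sup>2 \<le> a v"
      using member_le_sum[OF that, of "\<lambda>t. (P v t)\<^sup>2"] fin idem[of v] by (simp add: a_def)
    then show ?thesis using a_ge[of v] by (cases "a v = 0") (auto simp: power2_eq_square)
  qed
  have sum_a: "\<alpha> + \<beta> = real k"
  proof -
    have "\<alpha> + \<beta> = (\<Sum>v\<in>V. a v)"
      using ST by (simp add: \<alpha>_def \<beta>_def flip: sum.union_disjoint)
    also have "\<dots> = (\<Sum>i<k. \<Sum>v\<in>V. w i v * w i v)" unfolding a_def P_def by (rule sum.swap)
    also have "\<dots> = real k" using on by (simp add: orthonormal_on_def)
    finally show ?thesis .
  qed
  \<comment> \<open>Bessel for the difference of the two unit vectors at \<open>v\<close> and \<open>t\<close>, of squared length 2.\<close>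
  have D_le: "D v t \<le> 2" if "v \<in> V" "t \<in> V" "v \<noteq> t" for v t
  proof -
    define f where "f x = (of_bool (x = v) - of_bool (x = t) :: real)" for x
    have *: "(\<Sum>x\<in>V. f x * g x) = g v - g t" for g
    proof -
      have "(\<Sum>x\<in>V. f x * g x) = (\<Sum>x\<in>V. if x = v then g x else 0) - (\<Sum>x\<in>V. if x = t then g x else 0)"
        unfolding sum_subtractf[symmetric] by (intro sum.cong refl) (auto simp: f_def)
      then show ?thesis using that fin by simp
    qed
    have "(\<Sum>x\<in>V. (f x)\<^sup>2) = 2"
      using *[of f] that by (simp add: power2_eq_square f_def)
    then show ?thesis using bessel[OF on, of f] by (simp add: * D_def)
  qed
  have alpha0: "0 \<le> \<alpha>" "0 \<le> \<beta>" by (simp_all add: \<alpha>_def \<beta>_def a_ge sum_nonneg)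
  have alpha_le: "\<alpha> \<le> real q" using sum_a alpha0 kq by simp

  have SS: "(\<Sum>v\<in>S. \<Sum>t\<in>N v \<inter> S. D v t) \<le> 2 * real s * \<alpha>"
  proof -
    have "(\<Sum>v\<in>S. \<Sum>t\<in>N v \<inter> S. D v t) \<le> (\<Sum>v\<in>S. \<Sum>t\<in>S. D v t)"
      using ST by (intro sum_mono sum_mono2) (auto simp: D_def sum_nonneg)
    also have "\<dots> = (\<Sum>v\<in>S. real s * a v + \<alpha> - 2 * (\<Sum>t\<in>S. P v t))"
      by (simp add: D_eq sum.distrib sum_subtractf s_def \<alpha>_def sum_distrib_left)
    also have "\<dots> = 2 * real s * \<alpha> - 2 * (\<Sum>v\<in>S. \<Sum>t\<in>S. P v t)"
      by (simp add: sum.distrib sum_subtractf flip: sum_distrib_left)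
        (simp add: \<alpha>_def s_def)
    also have "(\<Sum>v\<in>S. \<Sum>t\<in>S. P v t) = (\<Sum>i<k. (\<Sum>v\<in>S. w i v)\<^sup>2)"
    proof -
      have "(\<Sum>v\<in>S. \<Sum>t\<in>S. P v t) = (\<Sum>v\<in>S. \<Sum>i<k. \<Sum>t\<in>S. w i v * w i t)"
        unfolding P_def by (intro sum.cong refl sum.swap)
      also have "\<dots> = (\<Sum>i<k. \<Sum>v\<in>S. \<Sum>t\<in>S. w i v * w i t)" by (rule sum.swap)
      finally show ?thesis by (simp add: power2_eq_square sum_product)
    qed
    finally show ?thesis using sum_nonneg[of "{..<k}" "\<lambda>i. (\<Sum>v\<in>S. w i v)\<^sup>2"] by simp
  qed

  have star: "(\<Sum>t\<in>N v \<inter> T. D v t) \<le> real (e v) + a v + \<beta>" if "v \<in> S" for v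
  proof -
    have vV: "v \<in> V" and vT: "v \<notin> T" using that ST by auto
    have "(\<Sum>t\<in>N v \<inter> T. (P v t)\<^sup>2) + (P v v)\<^sup>2 = (\<Sum>t\<in>insert v (N v \<inter> T). (P v t)\<^sup>2)"
      using fN vT by simp
    also have "\<dots> \<le> (\<Sum>t\<in>V. (P v t)\<^sup>2)" using ST vV fin by (intro sum_mono2) auto
    finally have "(\<Sum>t\<in>N v \<inter> T. (P v t)\<^sup>2) \<le> a v - (a v)\<^sup>2" using idem[of v] by (simp add: a_def)
    then have cr: "- 2 * (\<Sum>t\<in>N v \<inter> T. P v t) \<le> real (e v) * (1 - a v) + a v"
      unfolding e_def using fN a_ge a_le[OF vV] by (intro star_cross_term) auto
    have "(\<Sum>t\<in>N v \<inter> T. D v t) = real (e v) * a v + (\<Sum>t\<in>N v \<inter> T. a t) - 2 * (\<Sum>t\<in>N v \<inter> T. P v t)"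
      by (simp add: D_eq sum.distrib sum_subtractf e_def sum_distrib_left)
    moreover have "(\<Sum>t\<in>N v \<inter> T. a t) \<le> \<beta>"
      unfolding \<beta>_def using ST a_ge by (intro sum_mono2) auto
    ultimately show ?thesis using cr by (simp add: algebra_simps)
  qed
  have STsum: "(\<Sum>v\<in>S. \<Sum>t\<in>N v \<inter> T. D v t) \<le> real E + \<alpha> + real s * \<beta>"
  proof -
    have "(\<Sum>v\<in>S. \<Sum>t\<in>N v \<inter> T. D v t) \<le> (\<Sum>v\<in>S. real (e v) + a v + \<beta>)" using star by (intro sum_mono)
    then show ?thesis by (simp add: sum.distrib E_def \<alpha>_def s_def)
  qed
  have TT: "(\<Sum>v\<in>T. \<Sum>t\<in>N v \<inter> T. D v t) \<le> 2 * real c"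
  proof -
    have "(\<Sum>v\<in>T. \<Sum>t\<in>N v \<inter> T. D v t) \<le> (\<Sum>v\<in>T. \<Sum>t\<in>N v \<inter> T. 2)"
      using ST irr by (intro sum_mono D_le) (auto simp: N_def)
    then show ?thesis by (simp add: c_def sum_distrib_left mult.commute)
  qed

  have TS: "(\<Sum>v\<in>T. \<Sum>t\<in>N v \<inter> S. f v t) = (\<Sum>v\<in>S. \<Sum>t\<in>N v \<inter> T. f t v)" for f :: "'v \<Rightarrow> 'v \<Rightarrow> 'z::comm_monoid_add"
  proof -
    have N1: "N v \<inter> S = {t \<in> S. adj v t}" "N v \<inter> T = {t \<in> T. adj v t}" for v
      using ST by (auto simp: N_def)
    have "(\<Sum>v\<in>T. \<Sum>t\<in>N v \<inter> S. f v t) = (\<Sum>t\<in>S. \<Sum>v | v \<in> T \<and> adj v t. f v t)"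
      unfolding N1 using ST by (intro sum.swap_restrict)
    also have "\<dots> = (\<Sum>t\<in>S. \<Sum>v | v \<in> T \<and> adj t v. f v t)"
      using sym by (intro sum.cong refl) auto
    finally show ?thesis unfolding N1 .
  qed
  have split: "(\<Sum>t\<in>N v. D v t) = (\<Sum>t\<in>N v \<inter> S. D v t) + (\<Sum>t\<in>N v \<inter> T. D v t)" for v
  proof -
    have "(\<Sum>t\<in>N v. D v t) = (\<Sum>t\<in>(N v \<inter> S) \<union> (N v \<inter> T). D v t)" using NV[of v] by simp
    also have "\<dots> = (\<Sum>t\<in>N v \<inter> S. D v t) + (\<Sum>t\<in>N v \<inter> T. D v t)"
      using fN ST by (intro sum.union_disjoint) auto
    finally show ?thesis .
  qed
  have TS_D: "(\<Sum>v\<in>T. \<Sum>t\<in>N v \<inter> S. D v t) = (\<Sum>v\<in>S. \<Sum>t\<in>N v \<inter> T. D v t)"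
    unfolding TS by (intro sum.cong refl D_sym)
  define X where "X = (\<Sum>v\<in>V. \<Sum>t\<in>N v. D v t)"
  have "X = (\<Sum>v\<in>S. \<Sum>t\<in>N v. D v t) + (\<Sum>v\<in>T. \<Sum>t\<in>N v. D v t)"
    using ST unfolding X_def by (simp flip: sum.union_disjoint)
  also have "\<dots> = ((\<Sum>v\<in>S. \<Sum>t\<in>N v \<inter> S. D v t) + (\<Sum>v\<in>S. \<Sum>t\<in>N v \<inter> T. D v t))
      + ((\<Sum>v\<in>T. \<Sum>t\<in>N v \<inter> S. D v t) + (\<Sum>v\<in>T. \<Sum>t\<in>N v \<inter> T. D v t))"
    unfolding sum.distrib[symmetric] using split by simp
  finally have X: "X = (\<Sum>v\<in>S. \<Sum>t\<in>N v \<inter> S. D v t) + 2 * (\<Sum>v\<in>S. \<Sum>t\<in>N v \<inter> T. D v t)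
      + (\<Sum>v\<in>T. \<Sum>t\<in>N v \<inter> T. D v t)"
    by (simp add: TS_D)
  have m_eq: "m = s * q + E + c"
  proof -
    have "m = (\<Sum>v\<in>S. min (card (N v)) q) + (\<Sum>v\<in>T. min (card (N v)) q)"
      unfolding m_def N_def[symmetric] using ST by (simp flip: sum.union_disjoint)
    also have "(\<Sum>v\<in>S. min (card (N v)) q) = (\<Sum>v\<in>S. q)" by (intro sum.cong refl) (auto simp: S_def)
    also have "(\<Sum>v\<in>T. min (card (N v)) q) = (\<Sum>v\<in>T. card (N v \<inter> S) + card (N v \<inter> T))"
    proof (intro sum.cong refl)
      fix v assume "v \<in> T"
      then have "\<not> q < card (N v)" by (auto simp: S_def T_def)
      then show "min (card (N v)) q = card (N v \<inter> S) + card (N v \<inter> T)" using cardN[of v] by simp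
    qed
    also have "(\<Sum>v\<in>T. card (N v \<inter> S)) = E"
      using TS[of "\<lambda>_ _. 1::nat"] by (simp add: E_def e_def)
    then have "(\<Sum>v\<in>T. card (N v \<inter> S) + card (N v \<inter> T)) = E + c" by (simp add: sum.distrib c_def)
    finally show ?thesis by (simp add: s_def)
  qed
  show m2q: "2 * q < m"
  proof -
    have "v0 \<notin> N v0" using irr by (simp add: N_def)
    have "q + card (N v0) = min (card (N v0)) q + (\<Sum>v\<in>N v0. 1)" using v0 by (simp add: N_def)
    also have "\<dots> \<le> min (card (N v0)) q + (\<Sum>v\<in>N v0. min (card (N v)) q)"
    proof (intro add_left_mono sum_mono)
      fix v assume "v \<in> N v0"
      then have "v0 \<in> N v" using sym v0 by (auto simp: N_def)
      then have "card (N v) > 0" using fN by (auto simp: card_gt_0_iff)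
      then show "1 \<le> min (card (N v)) q" using q by simp
    qed
    also have "\<dots> = (\<Sum>v\<in>insert v0 (N v0). min (card (N v)) q)"
      using \<open>v0 \<notin> N v0\<close> fN by simp
    also have "\<dots> \<le> m" unfolding m_def N_def[symmetric]
      using v0 fin by (intro sum_mono2) (auto simp: N_def)
    finally show ?thesis using v0 by (simp add: N_def)
  qed
  have sq: "real s * \<alpha> + real s * \<beta> \<le> real (s * q)"
  proof -
    have "real s * \<alpha> + real s * \<beta> = real s * real k" unfolding sum_a[symmetric] by (simp add: algebra_simps)
    also have "\<dots> \<le> real s * real q" using kq by (intro mult_left_mono) auto
    finally show ?thesis by simp
  qed
  have s0: "s > 0" using v0S ST by (auto simp: s_def card_gt_0_iff)
  have "X < 3 * real m - 2 * real q"
  proof (cases "s = 1 \<or> E = 0")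
    case True
    then have "X \<le> 2 * real m"
    proof
      \<comment> \<open>No edge inside \<open>S\<close>: the term \<open>s \<alpha>\<close> disappears and pays for the error \<open>\<alpha>\<close> of the star.\<close>
      assume s1: "s = 1"
      then have "S = {v0}" using v0S by (auto simp: s_def card_1_singleton_iff)
      then have "(\<Sum>v\<in>S. \<Sum>t\<in>N v \<inter> S. D v t) = 0" using irr by (simp add: N_def)
      then have "X \<le> 2 * (real E + \<alpha> + \<beta>) + 2 * real c" using X STsum TT s1 by simp
      also have "\<dots> \<le> 2 * real m" using m_eq s1 sum_a kq by simp
      finally show ?thesis .
    next
      assume "E = 0"
      then have "\<forall>v\<in>S. N v \<inter> T = {}" using fN ST by (auto simp: E_def e_def)
      then have "(\<Sum>v\<in>S. \<Sum>t\<in>N v \<inter> T. D v t) = 0" by simp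
      then have "X \<le> 2 * real s * \<alpha> + 2 * real c" using X SS TT by simp
      also have "\<dots> \<le> 2 * (real s * real q) + 2 * real c" using alpha_le by (simp add: mult_left_mono)
      finally show ?thesis using m_eq by simp
    qed
    then show ?thesis using m2q by simp
  next
    case False
    then have s2: "s \<ge> 2" and E1: "E \<ge> 1" using s0 by auto
    have "X < 2 * real m + 2 * real q"
    proof (cases "\<alpha> = real q")
      \<comment> \<open>Strictness when the error is as large as possible: then the whole mass of \<open>a\<close> lies on \<open>S\<close>, the
        frame vanishes on \<open>T\<close>, and each edge leaving \<open>S\<close> contributes at most 1.\<close>
      case True
      then have "\<beta> = 0" using sum_a alpha0 kq by simp
      then have "a t = 0" if "t \<in> T" for t
        using that ST a_ge by (simp add: \<beta>_def sum_nonneg_eq_0_iff)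
      then have "w i t = 0" if "t \<in> T" "i < k" for i t
        using that by (auto simp: a_def P_def sum_nonneg_eq_0_iff)
      then have "D v t \<le> 1" if "t \<in> T" "v \<in> S" for v t
        using a_le[of v] that ST by (auto simp: D_def a_def P_def power2_eq_square)
      then have "(\<Sum>v\<in>S. \<Sum>t\<in>N v \<inter> T. D v t) \<le> (\<Sum>v\<in>S. \<Sum>t\<in>N v \<inter> T. 1)"
        by (intro sum_mono) auto
      then have "(\<Sum>v\<in>S. \<Sum>t\<in>N v \<inter> T. D v t) \<le> real E" by (simp add: E_def e_def)
      then have "X \<le> 2 * (real s * \<alpha>) + 2 * real E + 2 * real c" using X SS TT by simp
      also have "\<dots> = 2 * real m" using True by (simp add: m_eq)
      finally show ?thesis using q by simp
    next
      case False
      then have "\<alpha> < real q" using alpha_le by simp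
      moreover have "X \<le> 2 * (real s * \<alpha>) + 2 * (real E + \<alpha> + real s * \<beta>) + 2 * real c"
        using X SS STsum TT by simp
      ultimately show ?thesis using sq by (simp add: m_eq)
    qed
    moreover have "4 * q \<le> m"
    proof -
      \<comment> \<open>A vertex of \<open>S\<close> has more than \<open>q\<close> neighbours, of which at most \<open>s - 1\<close> are in \<open>S\<close>. For small
        \<open>s\<close> this forces many edges into \<open>T\<close>; for \<open>s \<ge> 4\<close> the bound is immediate from \<open>m \<ge> s q\<close>.\<close>
      have ev: "q + 2 \<le> s + e v" if "v \<in> S" for v
      proof -
        have "N v \<inter> S \<subseteq> S - {v}" using irr by (auto simp: N_def)
        then have "card (N v \<inter> S) \<le> s - 1"
          using that ST card_mono[of "S - {v}" "N v \<inter> S"] by (simp add: s_def)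
        moreover have "q < card (N v)" using that by (simp add: S_def)
        ultimately show ?thesis using cardN[of v] s0 by (simp add: e_def)
      qed
      have "(\<Sum>v\<in>S. q + 2) \<le> (\<Sum>v\<in>S. s + e v)" using ev by (intro sum_mono) auto
      then have sE: "s * (q + 2) \<le> s * s + E" by (simp add: sum.distrib E_def s_def)
      consider "s = 2" | "s = 3" | "s \<ge> 4" using s2 by linarith
      then show ?thesis
      proof cases
        case 3
        then have "4 * q \<le> s * q" by (rule mult_right_mono) simp
        then show ?thesis unfolding m_eq by linarith
      qed (use sE m_eq E1 q in auto)
    qed
    ultimately show ?thesis by linarith
  qed
  moreover have "(\<Sum>i<k. \<Sum>v\<in>V. \<Sum>t | t \<in> V \<and> adj v t. (w i v - w i t)\<^sup>2) = X"
  proof -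
    have "(\<Sum>i<k. \<Sum>v\<in>V. \<Sum>t\<in>N v. (w i v - w i t)\<^sup>2) = (\<Sum>v\<in>V. \<Sum>i<k. \<Sum>t\<in>N v. (w i v - w i t)\<^sup>2)"
      by (rule sum.swap)
    also have "\<dots> = X" unfolding X_def D_def by (intro sum.cong refl sum.swap)
    finally show ?thesis by (simp add: N_def)
  qed
  ultimately show "(\<Sum>i<k. \<Sum>v\<in>V. \<Sum>t | t \<in> V \<and> adj v t. (w i v - w i t)\<^sup>2) < 3 * real m - 2 * real q"
    by simp
qed

section \<open>Localisation at faces of codimension two\<close>

lemma square_sum_pairwise_zero:
  fixes c :: "'b \<Rightarrow> real"
  assumes "finite A" "\<And>x y. x \<in> A \<Longrightarrow> y \<in> A \<Longrightarrow> x \<noteq> y \<Longrightarrow> c x * c y = 0"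
  shows "(sum c A)\<^sup>2 = (\<Sum>x\<in>A. (c x)\<^sup>2)"
proof -
  have "(sum c A)\<^sup>2 = (\<Sum>x\<in>A. \<Sum>y\<in>A. c x * c y)" by (simp add: power2_eq_square sum_product)
  also have "\<dots> = (\<Sum>x\<in>A. \<Sum>y\<in>A. if x = y then (c x)\<^sup>2 else 0)"
    using assms(2) by (intro sum.cong refl) (auto simp: power2_eq_square)
  finally show ?thesis using assms(1) by simp
qed

lemma codim2_face:
  assumes "finite F" "card F = r + 1" "\<eta> \<subseteq> F" "card \<eta> = r - 1" "r \<ge> 1"
  obtains x y where "x \<noteq> y" "x \<notin> \<eta>" "y \<notin> \<eta>" "F = insert x (insert y \<eta>)"
    "{\<tau>. card \<tau> = r \<and> \<eta> \<subseteq> \<tau> \<and> \<tau> \<subseteq> F} = {insert x \<eta>, insert y \<eta>}"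
proof -
  have f: "finite \<eta>" using assms finite_subset by blast
  have "card (F - \<eta>) = 2" using assms f by (simp add: card_Diff_subset)
  then obtain x y where xy: "F - \<eta> = {x, y}" "x \<noteq> y" by (auto simp: card_2_iff)
  then have F: "F = insert x (insert y \<eta>)" "x \<notin> \<eta>" "y \<notin> \<eta>" using assms(3) by auto
  have "\<tau> = insert x \<eta> \<or> \<tau> = insert y \<eta>" if "card \<tau> = r" "\<eta> \<subseteq> \<tau>" "\<tau> \<subseteq> F" for \<tau>
  proof -
    have "card (\<tau> - \<eta>) = 1" using that assms f by (simp add: card_Diff_subset)
    then obtain z where "\<tau> - \<eta> = {z}" by (auto simp: card_1_singleton_iff)
    moreover from this have "z = x \<or> z = y" using that xy by auto
    ultimately show ?thesis using that by auto
  qed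
  then have "{\<tau>. card \<tau> = r \<and> \<eta> \<subseteq> \<tau> \<and> \<tau> \<subseteq> F} = {insert x \<eta>, insert y \<eta>}"
    using F f assms by auto
  then show thesis using that xy F by blast
qed

text \<open>The part of a simplicial complex that the main inequality uses: \<open>R\<close> and \<open>C\<close> are the simplices with
  \<open>r\<close> and \<open>r + 1\<close> vertices, and \<open>b F \<tau>\<close> is the incidence sign. The last assumption is \<open>\<partial>\<partial> = 0\<close>, seen
  from a fixed \<open>\<eta>\<close>: the signs \<open>\<sigma> \<tau>\<close> play the role of the incidence of \<open>\<eta>\<close> in \<open>\<tau>\<close>.\<close>

locale signed_incidence =
  fixes R C :: "'a set set" and r :: nat and b :: "'a set \<Rightarrow> 'a set \<Rightarrow> real"
  assumes r2: "r \<ge> 2" and finR: "finite R" and finC: "finite C"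
    and C: "\<And>F. F \<in> C \<Longrightarrow> finite F \<and> card F = r + 1"
    and R: "\<And>\<tau>. \<tau> \<in> R \<Longrightarrow> finite \<tau> \<and> card \<tau> = r"
    and facet: "\<And>F \<tau>. F \<in> C \<Longrightarrow> \<tau> \<subseteq> F \<Longrightarrow> card \<tau> = r \<Longrightarrow> \<tau> \<in> R"
    and b_in: "\<And>F \<tau>. F \<in> C \<Longrightarrow> \<tau> \<in> R \<Longrightarrow> \<tau> \<subseteq> F \<Longrightarrow> (b F \<tau>)\<^sup>2 = 1"
    and b_out: "\<And>F \<tau>. F \<in> C \<Longrightarrow> \<tau> \<in> R \<Longrightarrow> \<not> \<tau> \<subseteq> F \<Longrightarrow> b F \<tau> = 0"
    and boundary2: "\<And>\<eta>. \<exists>\<sigma>. (\<forall>\<tau>. (\<sigma> \<tau>)\<^sup>2 = 1) \<and> (\<forall>F\<in>C. \<forall>\<tau>\<in>R. \<forall>\<tau>'\<in>R.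
      card \<eta> = r - 1 \<longrightarrow> \<eta> \<subseteq> \<tau> \<longrightarrow> \<eta> \<subseteq> \<tau>' \<longrightarrow> \<tau> \<noteq> \<tau>' \<longrightarrow> \<tau> \<subseteq> F \<longrightarrow> \<tau>' \<subseteq> F \<longrightarrow>
      b F \<tau> * \<sigma> \<tau> + b F \<tau>' * \<sigma> \<tau>' = (0::real))"
begin

definition up_deg :: "'a set \<Rightarrow> nat" where "up_deg \<tau> = card {F \<in> C. \<tau> \<subseteq> F}"

lemma card_facets: "F \<in> C \<Longrightarrow> card {\<tau> \<in> R. \<tau> \<subseteq> F} = r + 1"
proof -
  assume F: "F \<in> C"
  have "{\<tau> \<in> R. \<tau> \<subseteq> F} = {\<tau>. \<tau> \<subseteq> F \<and> card \<tau> = r}" using R facet[OF F] by auto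
  then show ?thesis using n_subsets[of F r] C[OF F] by (simp add: binomial_symmetric)
qed

lemma sum_b_sq: "F \<in> C \<Longrightarrow> (\<Sum>\<tau>\<in>R. (b F \<tau>)\<^sup>2) = real r + 1"
proof -
  assume F: "F \<in> C"
  have "(\<Sum>\<tau>\<in>R. (b F \<tau>)\<^sup>2) = (\<Sum>\<tau>\<in>R. if \<tau> \<subseteq> F then 1 else 0)"
    using b_in[OF F] b_out[OF F] by (intro sum.cong refl) auto
  also have "\<dots> = real (card {\<tau> \<in> R. \<tau> \<subseteq> F})" using finR by (simp add: sum.If_cases Int_def)
  finally show ?thesis using card_facets[OF F] by simp
qed

text \<open>
  The faces \<open>F \<supseteq> \<eta>\<close> are the edges, and the \<open>\<tau> \<supseteq> \<eta>\<close> the vertices, of the link graph of \<open>\<eta>\<close>. If no vertex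
  has degree above \<open>q\<close>, the claim is \<open>y F \<le> r + 1\<close> summed over the edges, because \<open>m\<close> is then twice the
  number of edges. Otherwise the given frame is transferred to the edges of the link graph. There the
  \<open>\<tau>\<close> outside of the link graph contribute \<open>r - 1\<close> times the identity, and the rest is
  transferred back to a frame on the vertices of the link graph, to which \<open>weak_grone_merris\<close> applies. The
  two bounds add up to
  \<open>2 (r - 1) q + (3 m - 2 q) = 3 m + (r - 2) (2 q)\<close>, which is at most \<open>(r + 1) m\<close> as \<open>2 q < m\<close>.
\<close>

lemma codim2_bound:
  assumes \<eta>: "card \<eta> = r - 1" and u: "orthonormal_on R k u" and kq: "k \<le> q" and q: "1 \<le> q"
  defines "y \<equiv> (\<lambda>F. \<Sum>i<k. (\<Sum>\<tau>\<in>R. b F \<tau> * u i \<tau>)\<^sup>2)"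
    and "m \<equiv> (\<Sum>\<tau> | \<tau> \<in> R \<and> \<eta> \<subseteq> \<tau>. min (up_deg \<tau>) q)"
  shows "2 * (\<Sum>F | F \<in> C \<and> \<eta> \<subseteq> F. y F) \<le> real (r + 1) * real m"
    and "\<tau>0 \<in> R \<Longrightarrow> \<eta> \<subseteq> \<tau>0 \<Longrightarrow> q < up_deg \<tau>0 \<Longrightarrow>
      2 * (\<Sum>F | F \<in> C \<and> \<eta> \<subseteq> F. y F) < real (r + 1) * real m"
proof -
  define V where "V = {\<tau> \<in> R. \<eta> \<subseteq> \<tau>}"
  define E where "E = {F \<in> C. \<eta> \<subseteq> F}"
  have finV: "finite V" and finE: "finite E" using finR finC by (auto simp: V_def E_def)
  define ends where "ends F = {\<tau> \<in> V. \<tau> \<subseteq> F}" for F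
  have ends: "\<exists>x z. x \<noteq> z \<and> x \<notin> \<eta> \<and> z \<notin> \<eta> \<and> F = insert x (insert z \<eta>) \<and> ends F = {insert x \<eta>, insert z \<eta>}"
    if "F \<in> E" for F
  proof -
    have F: "F \<in> C" "\<eta> \<subseteq> F" using that by (auto simp: E_def)
    have "r \<ge> 1" "finite F" "card F = r + 1" using r2 C[OF F(1)] by auto
    then obtain x z where xz: "x \<noteq> z" "x \<notin> \<eta>" "z \<notin> \<eta>" "F = insert x (insert z \<eta>)"
      "{\<tau>. card \<tau> = r \<and> \<eta> \<subseteq> \<tau> \<and> \<tau> \<subseteq> F} = {insert x \<eta>, insert z \<eta>}"
      using codim2_face[OF _ _ F(2) \<eta>] by blast
    have "ends F = {\<tau>. card \<tau> = r \<and> \<eta> \<subseteq> \<tau> \<and> \<tau> \<subseteq> F}"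
      using R facet[OF F(1)] by (auto simp: ends_def V_def)
    then have "ends F = {insert x \<eta>, insert z \<eta>}" using xz(5) by simp
    with xz(1-4) show ?thesis by blast
  qed
  have card_ends: "card (ends F) = 2" if F: "F \<in> E" for F
  proof -
    obtain x z where "x \<noteq> z" "x \<notin> \<eta>" "z \<notin> \<eta>" "ends F = {insert x \<eta>, insert z \<eta>}"
      using ends[OF F] by blast
    moreover from this have "insert x \<eta> \<noteq> insert z \<eta>" by blast
    ultimately show ?thesis by simp
  qed
  have deg_E: "up_deg \<tau> = card {F \<in> E. \<tau> \<subseteq> F}" if "\<tau> \<in> V" for \<tau>
    unfolding up_deg_def using that by (intro arg_cong[where f = card]) (auto simp: E_def V_def)
  have sum_up_deg: "(\<Sum>\<tau>\<in>V. \<Sum>F | F \<in> E \<and> \<tau> \<subseteq> F. z F) = 2 * (\<Sum>F\<in>E. z F)" for z :: "'a set \<Rightarrow> real"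
  proof -
    have "(\<Sum>\<tau>\<in>V. \<Sum>F | F \<in> E \<and> \<tau> \<subseteq> F. z F) = (\<Sum>F\<in>E. \<Sum>\<tau> | \<tau> \<in> V \<and> \<tau> \<subseteq> F. z F)"
      by (rule sum.swap_restrict[OF finV finE])
    also have "\<dots> = (\<Sum>F\<in>E. 2 * z F)"
      using card_ends by (intro sum.cong refl) (simp add: ends_def)
    finally show ?thesis by (simp add: sum_distrib_left)
  qed
  have y_le: "y F \<le> real (r + 1)" if "F \<in> E" for F
    using bessel[OF u, of "b F"] sum_b_sq[of F] that by (simp add: y_def E_def)
  have strict: "2 * (\<Sum>F\<in>E. y F) < real (r + 1) * real m" if t0: "\<tau>0 \<in> V" "q < up_deg \<tau>0" for \<tau>0
  proof -
    have "(\<Sum>F\<in>E. y F) = (\<Sum>i<k. \<Sum>F\<in>E. (\<Sum>\<tau>\<in>R. b F \<tau> * u i \<tau>)\<^sup>2)"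
      unfolding y_def by (rule sum.swap)
    moreover obtain l v where l: "l \<le> k" and v: "orthonormal_on E l v"
      and "(\<Sum>i<k. \<Sum>F\<in>E. (\<Sum>\<tau>\<in>R. b F \<tau> * u i \<tau>)\<^sup>2) \<le> (\<Sum>j<l. \<Sum>\<tau>\<in>R. (\<Sum>F\<in>E. b F \<tau> * v j F)\<^sup>2)"
      using frame_transfer[OF finE u, of "\<lambda>\<tau> F. b F \<tau>"] by blast
    ultimately have y1: "(\<Sum>F\<in>E. y F) \<le> (\<Sum>j<l. \<Sum>\<tau>\<in>R. (\<Sum>F\<in>E. b F \<tau> * v j F)\<^sup>2)" by simp
    \<comment> \<open>A \<open>\<tau>\<close> outside of the link graph lies in at most one edge \<open>F\<close>, namely \<open>\<tau> \<union> \<eta>\<close>, so no cross terms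
      occur; and every edge has \<open>r - 1\<close> such facets.\<close>
    have off_link: "(\<Sum>\<tau>\<in>R - V. (\<Sum>F\<in>E. b F \<tau> * v j F)\<^sup>2) = real r - 1" if "j < l" for j
    proof -
      have uniq: "F = \<tau> \<union> \<eta>" if "F \<in> E" "\<tau> \<in> R - V" "\<tau> \<subseteq> F" for F \<tau>
      proof -
        have fF: "finite F" "card F = r + 1" using that C by (auto simp: E_def)
        have "\<tau> \<subset> \<tau> \<union> \<eta>" "\<tau> \<union> \<eta> \<subseteq> F" using that by (auto simp: V_def E_def)
        moreover from this have "finite (\<tau> \<union> \<eta>)" using fF finite_subset by blast
        ultimately have "card \<tau> < card (\<tau> \<union> \<eta>)" "card (\<tau> \<union> \<eta>) \<le> card F"
          using fF by (blast intro: psubset_card_mono, blast intro: card_mono)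
        moreover have "card \<tau> = r" using R that by blast
        ultimately show ?thesis using fF \<open>\<tau> \<union> \<eta> \<subseteq> F\<close>
          by (intro card_subset_eq[symmetric]) auto
      qed
      have "(\<Sum>F\<in>E. b F \<tau> * v j F)\<^sup>2 = (\<Sum>F\<in>E. (b F \<tau> * v j F)\<^sup>2)" if t: "\<tau> \<in> R - V" for \<tau>
      proof (rule square_sum_pairwise_zero[OF finE])
        fix F F' assume "F \<in> E" "F' \<in> E" "F \<noteq> F'"
        then have "\<not> \<tau> \<subseteq> F \<or> \<not> \<tau> \<subseteq> F'" using uniq[of F \<tau>] uniq[of F' \<tau>] t by auto
        then have "b F \<tau> = 0 \<or> b F' \<tau> = 0" using b_out \<open>F \<in> E\<close> \<open>F' \<in> E\<close> t by (auto simp: E_def)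
        then show "b F \<tau> * v j F * (b F' \<tau> * v j F') = 0" by auto
      qed
      then have "(\<Sum>\<tau>\<in>R - V. (\<Sum>F\<in>E. b F \<tau> * v j F)\<^sup>2) = (\<Sum>\<tau>\<in>R - V. \<Sum>F\<in>E. (b F \<tau> * v j F)\<^sup>2)"
        by (intro sum.cong refl) auto
      also have "\<dots> = (\<Sum>F\<in>E. (\<Sum>\<tau>\<in>R - V. (b F \<tau>)\<^sup>2) * (v j F)\<^sup>2)"
        by (subst sum.swap) (simp add: power_mult_distrib sum_distrib_right)
      also have "\<dots> = (\<Sum>F\<in>E. (real r - 1) * (v j F)\<^sup>2)"
      proof (intro sum.cong refl arg_cong2[where f = "(*)"])
        fix F assume F: "F \<in> E"
        then have FC: "F \<in> C" by (simp add: E_def)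
        have "(\<Sum>\<tau>\<in>V. (b F \<tau>)\<^sup>2) = (\<Sum>\<tau>\<in>ends F. (b F \<tau>)\<^sup>2)"
          using finV b_out[OF FC] by (intro sum.mono_neutral_right) (auto simp: ends_def V_def)
        also have "\<dots> = (\<Sum>\<tau>\<in>ends F. 1)"
          using b_in[OF FC] by (intro sum.cong refl) (auto simp: ends_def V_def)
        finally have "(\<Sum>\<tau>\<in>V. (b F \<tau>)\<^sup>2) = 2" using card_ends[OF F] by simp
        then show "(\<Sum>\<tau>\<in>R - V. (b F \<tau>)\<^sup>2) = real r - 1"
          using sum_b_sq[OF FC] finR by (subst sum_diff) (auto simp: V_def)
      qed
      also have "\<dots> = real r - 1"
        using orthonormal_onD[OF v that that] by (simp add: power2_eq_square flip: sum_distrib_left)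
      finally show ?thesis .
    qed
    have y2: "(\<Sum>F\<in>E. y F) \<le> (real r - 1) * real q + (\<Sum>j<l. \<Sum>\<tau>\<in>V. (\<Sum>F\<in>E. b F \<tau> * v j F)\<^sup>2)"
    proof -
      have "(\<Sum>j<l. \<Sum>\<tau>\<in>R. (\<Sum>F\<in>E. b F \<tau> * v j F)\<^sup>2)
        = (\<Sum>j<l. (\<Sum>\<tau>\<in>R - V. (\<Sum>F\<in>E. b F \<tau> * v j F)\<^sup>2) + (\<Sum>\<tau>\<in>V. (\<Sum>F\<in>E. b F \<tau> * v j F)\<^sup>2))"
        using finR by (intro sum.cong refl sum.subset_diff) (auto simp: V_def)
      also have "\<dots> = real l * (real r - 1) + (\<Sum>j<l. \<Sum>\<tau>\<in>V. (\<Sum>F\<in>E. b F \<tau> * v j F)\<^sup>2)"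
        using off_link by (simp add: sum.distrib)
      also have "real l * (real r - 1) \<le> real q * (real r - 1)"
        using l kq r2 by (intro mult_right_mono) auto
      finally show ?thesis using y1 by (simp add: mult.commute)
    qed
    obtain k' w where k': "k' \<le> l" and w: "orthonormal_on V k' w"
      and y3: "(\<Sum>j<l. \<Sum>\<tau>\<in>V. (\<Sum>F\<in>E. b F \<tau> * v j F)\<^sup>2) \<le> (\<Sum>i<k'. \<Sum>F\<in>E. (\<Sum>\<tau>\<in>V. b F \<tau> * w i \<tau>)\<^sup>2)"
      using frame_transfer[OF finV v, of "\<lambda>F \<tau>. b F \<tau>"] by blast
    obtain \<sigma> where \<sigma>1: "\<And>\<tau>. (\<sigma> \<tau>)\<^sup>2 = (1::real)"
      and \<sigma>: "\<forall>F\<in>C. \<forall>\<tau>\<in>R. \<forall>\<tau>'\<in>R. card \<eta> = r - 1 \<longrightarrow> \<eta> \<subseteq> \<tau> \<longrightarrow> \<eta> \<subseteq> \<tau>' \<longrightarrow> \<tau> \<noteq> \<tau>' \<longrightarrow>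
        \<tau> \<subseteq> F \<longrightarrow> \<tau>' \<subseteq> F \<longrightarrow> b F \<tau> * \<sigma> \<tau> + b F \<tau>' * \<sigma> \<tau>' = 0"
      using boundary2[of \<eta>] by blast
    have \<sigma>2: "b F \<tau> * \<sigma> \<tau> + b F \<tau>' * \<sigma> \<tau>' = 0"
      if "F \<in> E" "\<tau> \<in> ends F" "\<tau>' \<in> ends F" "\<tau> \<noteq> \<tau>'" for F \<tau> \<tau>'
      using that \<eta> \<sigma> unfolding ends_def V_def E_def by blast
    \<comment> \<open>After this change of signs every edge reads off a difference of two vertex values.\<close>
    define x where "x i \<tau> = \<sigma> \<tau> * w i \<tau>" for i \<tau>
    have x: "orthonormal_on V k' x"
    proof -
      have "x i \<tau> * x j \<tau> = w i \<tau> * w j \<tau>" for i j \<tau>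
        using \<sigma>1[of \<tau>] by (simp add: x_def power2_eq_square algebra_simps)
      then show ?thesis using w by (simp add: orthonormal_on_def)
    qed
    define adj where "adj \<tau> \<tau>' \<longleftrightarrow> \<tau> \<noteq> \<tau>' \<and> \<tau> \<union> \<tau>' \<in> E" for \<tau> \<tau>'
    have adj_sym: "adj \<tau> \<tau>' \<Longrightarrow> adj \<tau>' \<tau>" and adj_irr: "\<not> adj \<tau> \<tau>" for \<tau> \<tau>'
      by (auto simp: adj_def Un_commute)
    have bij: "bij_betw (\<lambda>\<tau>'. \<tau> \<union> \<tau>') {\<tau>' \<in> V. adj \<tau> \<tau>'} {F \<in> E. \<tau> \<subseteq> F}" if t: "\<tau> \<in> V" for \<tau>
    proof (rule bij_betwI')
      have ends_pair: "ends F = {\<tau>, \<tau>'}" if "\<tau>' \<in> V" "adj \<tau> \<tau>'" "F = \<tau> \<union> \<tau>'" for \<tau>' F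
      proof -
        have "F \<in> E" "{\<tau>, \<tau>'} \<subseteq> ends F" "\<tau> \<noteq> \<tau>'" using that t by (auto simp: adj_def ends_def)
        then show ?thesis using card_ends[of F] card_subset_eq[of "ends F" "{\<tau>, \<tau>'}"] finV
          by (auto simp: ends_def)
      qed
      fix \<tau>1 \<tau>2 assume "\<tau>1 \<in> {\<tau>' \<in> V. adj \<tau> \<tau>'}" "\<tau>2 \<in> {\<tau>' \<in> V. adj \<tau> \<tau>'}"
      then show "(\<tau> \<union> \<tau>1 = \<tau> \<union> \<tau>2) = (\<tau>1 = \<tau>2)"
        using ends_pair[of \<tau>1] ends_pair[of \<tau>2] by (auto simp: doubleton_eq_iff)
    next
      fix \<tau>' assume "\<tau>' \<in> {\<tau>' \<in> V. adj \<tau> \<tau>'}"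
      then show "\<tau> \<union> \<tau>' \<in> {F \<in> E. \<tau> \<subseteq> F}" by (auto simp: adj_def)
    next
      fix F assume F: "F \<in> {F \<in> E. \<tau> \<subseteq> F}"
      then obtain p z where pz: "p \<noteq> z" "p \<notin> \<eta>" "z \<notin> \<eta>" "F = insert p (insert z \<eta>)"
        "ends F = {insert p \<eta>, insert z \<eta>}" using ends by blast
      have "\<tau> \<in> ends F" using F t by (simp add: ends_def)
      then consider "\<tau> = insert p \<eta>" | "\<tau> = insert z \<eta>" using pz by auto
      then show "\<exists>\<tau>'\<in>{\<tau>' \<in> V. adj \<tau> \<tau>'}. F = \<tau> \<union> \<tau>'"
      proof cases
        case 1
        then have "F = \<tau> \<union> insert z \<eta>" "\<tau> \<noteq> insert z \<eta>" "insert z \<eta> \<in> V"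
          using pz by (auto simp: ends_def)
        then show ?thesis using F by (auto simp: adj_def)
      next
        case 2
        then have "F = \<tau> \<union> insert p \<eta>" "\<tau> \<noteq> insert p \<eta>" "insert p \<eta> \<in> V"
          using pz by (auto simp: ends_def)
        then show ?thesis using F by (auto simp: adj_def)
      qed
    qed
    have deg_adj: "card {\<tau>' \<in> V. adj \<tau> \<tau>'} = up_deg \<tau>" if "\<tau> \<in> V" for \<tau>
      using bij_betw_same_card[OF bij[OF that]] deg_E[OF that] by simp
    define z where "z i F = (\<Sum>\<tau>\<in>V. b F \<tau> * w i \<tau>)\<^sup>2" for i F
    have z: "z i (\<tau> \<union> \<tau>') = (x i \<tau> - x i \<tau>')\<^sup>2" if t: "\<tau> \<in> V" "\<tau>' \<in> V" "adj \<tau> \<tau>'" for i \<tau> \<tau>'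
    proof -
      define F where "F = \<tau> \<union> \<tau>'"
      have F: "F \<in> E" "F \<in> C" "\<tau> \<noteq> \<tau>'" "{\<tau>, \<tau>'} \<subseteq> ends F" using t by (auto simp: adj_def F_def ends_def E_def)
      then have e: "ends F = {\<tau>, \<tau>'}"
        using card_ends[of F] card_subset_eq[of "ends F" "{\<tau>, \<tau>'}"] finV by (auto simp: ends_def)
      have "(\<Sum>\<tau>\<in>V. b F \<tau> * w i \<tau>) = (\<Sum>\<tau>\<in>ends F. b F \<tau> * w i \<tau>)"
        using finV b_out[OF F(2)] by (intro sum.mono_neutral_right) (auto simp: ends_def V_def)
      also have "\<dots> = b F \<tau> * w i \<tau> + b F \<tau>' * w i \<tau>'" using e F by simp
      also have "\<dots> = (b F \<tau> * \<sigma> \<tau>) * x i \<tau> + (b F \<tau>' * \<sigma> \<tau>') * x i \<tau>'"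
        using \<sigma>1[of \<tau>] \<sigma>1[of \<tau>'] by (simp add: x_def power2_eq_square) (metis mult.assoc mult_1)
      also have "b F \<tau>' * \<sigma> \<tau>' = - (b F \<tau> * \<sigma> \<tau>)" using \<sigma>2[of F \<tau> \<tau>'] F e by simp
      finally have "(\<Sum>\<tau>\<in>V. b F \<tau> * w i \<tau>) = (b F \<tau> * \<sigma> \<tau>) * (x i \<tau> - x i \<tau>')" by (simp add: algebra_simps)
      then have "z i F = (b F \<tau>)\<^sup>2 * (\<sigma> \<tau>)\<^sup>2 * (x i \<tau> - x i \<tau>')\<^sup>2" by (simp add: z_def power_mult_distrib)
      moreover have "(b F \<tau>)\<^sup>2 = 1" using b_in[OF F(2), of \<tau>] t by (auto simp: V_def F_def)
      ultimately show ?thesis using \<sigma>1 by (simp add: F_def)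
    qed
    have "(\<Sum>i<k'. \<Sum>\<tau>\<in>V. \<Sum>\<tau>' | \<tau>' \<in> V \<and> adj \<tau> \<tau>'. (x i \<tau> - x i \<tau>')\<^sup>2)
        = (\<Sum>i<k'. \<Sum>\<tau>\<in>V. \<Sum>F | F \<in> E \<and> \<tau> \<subseteq> F. z i F)"
    proof (rule sum.cong[OF refl], rule sum.cong[OF refl])
      fix i \<tau> assume t: "\<tau> \<in> V"
      have "(\<Sum>F | F \<in> E \<and> \<tau> \<subseteq> F. z i F) = (\<Sum>\<tau>' | \<tau>' \<in> V \<and> adj \<tau> \<tau>'. z i (\<tau> \<union> \<tau>'))"
        using sum.reindex_bij_betw[OF bij[OF t], of "z i"] by simp
      then show "(\<Sum>\<tau>' | \<tau>' \<in> V \<and> adj \<tau> \<tau>'. (x i \<tau> - x i \<tau>')\<^sup>2) = (\<Sum>F | F \<in> E \<and> \<tau> \<subseteq> F. z i F)"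
        using z[OF t] by simp
    qed
    also have "\<dots> = 2 * (\<Sum>i<k'. \<Sum>F\<in>E. z i F)" unfolding sum_up_deg by (simp add: sum_distrib_left)
    finally have graph: "(\<Sum>i<k'. \<Sum>\<tau>\<in>V. \<Sum>\<tau>' | \<tau>' \<in> V \<and> adj \<tau> \<tau>'. (x i \<tau> - x i \<tau>')\<^sup>2) = 2 * (\<Sum>i<k'. \<Sum>F\<in>E. z i F)" .
    have m_adj: "(\<Sum>\<tau>\<in>V. min (card {\<tau>' \<in> V. adj \<tau> \<tau>'}) q) = m"
      unfolding m_def V_def[symmetric] by (intro sum.cong refl) (simp add: deg_adj)
    have k'q: "k' \<le> q" using k' l kq by simp
    have t0': "q < card {\<tau>' \<in> V. adj \<tau>0 \<tau>'}" using t0 deg_adj by simp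
    note gm = weak_grone_merris[OF finV adj_sym adj_irr x k'q q t0(1) t0', unfolded m_adj graph]
    have "2 * (\<Sum>F\<in>E. y F) < 2 * (real r - 1) * real q + (3 * real m - 2 * real q)"
      using y2 y3 gm(1) by (simp add: z_def left_diff_distrib)
    also have "\<dots> = 3 * real m + (real r - 2) * (2 * real q)" by (simp add: algebra_simps)
    also have "\<dots> \<le> 3 * real m + (real r - 2) * real m"
      using gm(2) r2 by (intro add_left_mono mult_left_mono) auto
    finally show ?thesis by (simp add: algebra_simps)
  qed
  show "2 * (\<Sum>F | F \<in> C \<and> \<eta> \<subseteq> F. y F) < real (r + 1) * real m"
    if "\<tau>0 \<in> R" "\<eta> \<subseteq> \<tau>0" "q < up_deg \<tau>0"
    using strict[of \<tau>0] that by (simp add: V_def E_def)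
  show "2 * (\<Sum>F | F \<in> C \<and> \<eta> \<subseteq> F. y F) \<le> real (r + 1) * real m"
  proof (cases "\<exists>\<tau>0\<in>V. q < up_deg \<tau>0")
    case True
    then show ?thesis using strict by (force simp: E_def)
  next
    case False
    have "2 * (\<Sum>F\<in>E. y F) \<le> 2 * (\<Sum>F\<in>E. real (r + 1))" using y_le by (intro mult_left_mono sum_mono) auto
    also have "\<dots> = (\<Sum>\<tau>\<in>V. \<Sum>F | F \<in> E \<and> \<tau> \<subseteq> F. real (r + 1))" by (rule sum_up_deg[symmetric])
    also have "\<dots> = (\<Sum>\<tau>\<in>V. real (r + 1) * real (min (up_deg \<tau>) q))"
      using False deg_E by (intro sum.cong refl) (auto simp: not_less mult.commute)
    finally show ?thesis by (simp add: m_def V_def E_def sum_distrib_left)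
  qed
qed

text \<open>Summation of \<open>codim2_bound\<close> over all \<open>\<eta>\<close>. Strictness comes from any \<open>\<eta>\<close> below a \<open>\<tau>0\<close> of degree
  above \<open>q\<close>.\<close>

lemma frame_sum_less:
  assumes u: "orthonormal_on R k u" and kq: "k \<le> q" and q: "1 \<le> q"
    and t0: "\<tau>0 \<in> R" "q < up_deg \<tau>0"
  shows "(\<Sum>i<k. \<Sum>F\<in>C. (\<Sum>\<tau>\<in>R. b F \<tau> * u i \<tau>)\<^sup>2) < real (\<Sum>\<tau>\<in>R. min (up_deg \<tau>) q)"
proof -
  define y where "y F = (\<Sum>i<k. (\<Sum>\<tau>\<in>R. b F \<tau> * u i \<tau>)\<^sup>2)" for F
  define H where "H = {\<eta>. card \<eta> = r - 1 \<and> (\<exists>\<tau>\<in>R. \<eta> \<subseteq> \<tau>)}"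
  have finH: "finite H"
    by (rule finite_subset[of _ "\<Union>\<tau>\<in>R. Pow \<tau>"]) (use finR R in \<open>auto simp: H_def\<close>)
  obtain \<eta>0 where e0: "\<eta>0 \<subseteq> \<tau>0" "card \<eta>0 = r - 1"
    using R[OF t0(1)] by (metis diff_le_self obtain_subset_with_card_n)
  have "(\<Sum>\<eta>\<in>H. 2 * (\<Sum>F | F \<in> C \<and> \<eta> \<subseteq> F. y F))
      < (\<Sum>\<eta>\<in>H. real (r + 1) * real (\<Sum>\<tau> | \<tau> \<in> R \<and> \<eta> \<subseteq> \<tau>. min (up_deg \<tau>) q))"
  proof (rule sum_strict_mono_ex1[OF finH])
    show "\<forall>\<eta>\<in>H. 2 * (\<Sum>F | F \<in> C \<and> \<eta> \<subseteq> F. y F)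
        \<le> real (r + 1) * real (\<Sum>\<tau> | \<tau> \<in> R \<and> \<eta> \<subseteq> \<tau>. min (up_deg \<tau>) q)"
      unfolding y_def using codim2_bound(1)[OF _ u kq q] by (simp add: H_def)
    show "\<exists>\<eta>\<in>H. 2 * (\<Sum>F | F \<in> C \<and> \<eta> \<subseteq> F. y F)
        < real (r + 1) * real (\<Sum>\<tau> | \<tau> \<in> R \<and> \<eta> \<subseteq> \<tau>. min (up_deg \<tau>) q)"
      unfolding y_def using codim2_bound(2)[OF e0(2) u kq q t0(1) e0(1) t0(2)] e0 t0
      by (intro bexI[of _ \<eta>0]) (auto simp: H_def)
  qed
  also have "(\<Sum>\<eta>\<in>H. real (r + 1) * real (\<Sum>\<tau> | \<tau> \<in> R \<and> \<eta> \<subseteq> \<tau>. min (up_deg \<tau>) q))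
      = real (r + 1) * (\<Sum>\<tau>\<in>R. \<Sum>\<eta> | \<eta> \<in> H \<and> \<eta> \<subseteq> \<tau>. real (min (up_deg \<tau>) q))"
    unfolding sum.swap_restrict[OF finR finH] by (simp add: sum_distrib_left)
  also have "\<dots> = real (r + 1) * (\<Sum>\<tau>\<in>R. real r * real (min (up_deg \<tau>) q))"
  proof (intro sum.cong refl arg_cong2[where f = "(*)"])
    fix \<tau> assume t: "\<tau> \<in> R"
    have "{\<eta> \<in> H. \<eta> \<subseteq> \<tau>} = {\<eta>. \<eta> \<subseteq> \<tau> \<and> card \<eta> = r - 1}" using t by (auto simp: H_def)
    then have "card {\<eta> \<in> H. \<eta> \<subseteq> \<tau>} = r choose (r - 1)" using n_subsets[of \<tau> "r - 1"] R[OF t] by simp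
    also have "\<dots> = r" using r2 binomial_symmetric[of "r - 1" r] by simp
    finally show "(\<Sum>\<eta> | \<eta> \<in> H \<and> \<eta> \<subseteq> \<tau>. real (min (up_deg \<tau>) q)) = real r * real (min (up_deg \<tau>) q)" by simp
  qed
  also have "(\<Sum>\<eta>\<in>H. 2 * (\<Sum>F | F \<in> C \<and> \<eta> \<subseteq> F. y F)) = 2 * (\<Sum>F\<in>C. \<Sum>\<eta> | \<eta> \<in> H \<and> \<eta> \<subseteq> F. y F)"
    unfolding sum.swap_restrict[OF finC finH] by (simp add: sum_distrib_left)
  also have "\<dots> = (\<Sum>F\<in>C. 2 * (\<Sum>\<eta> | \<eta> \<in> H \<and> \<eta> \<subseteq> F. y F))"
    by (rule sum_distrib_left)
  also have "\<dots> = (\<Sum>F\<in>C. real ((r + 1) * r) * y F)"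
  proof (intro sum.cong refl)
    fix F assume F: "F \<in> C"
    have "\<exists>\<tau>\<in>R. \<eta> \<subseteq> \<tau>" if e: "\<eta> \<subseteq> F" "card \<eta> = r - 1" for \<eta>
    proof -
      have "r \<ge> 1" "finite F" "card F = r + 1" using r2 C[OF F] by auto
      then obtain x z where "x \<noteq> z" "x \<notin> \<eta>" "z \<notin> \<eta>" "F = insert x (insert z \<eta>)"
        "{\<tau>. card \<tau> = r \<and> \<eta> \<subseteq> \<tau> \<and> \<tau> \<subseteq> F} = {insert x \<eta>, insert z \<eta>}"
        using codim2_face[OF _ _ e] by blast
      then have "insert x \<eta> \<in> R" using facet[OF F] by blast
      then show ?thesis by blast
    qed
    then have "{\<eta> \<in> H. \<eta> \<subseteq> F} = {\<eta>. \<eta> \<subseteq> F \<and> card \<eta> = r - 1}" by (auto simp: H_def)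
    then have "card {\<eta> \<in> H. \<eta> \<subseteq> F} = (r + 1) choose (r - 1)"
      using n_subsets[of F "r - 1"] C[OF F] by simp
    also have "\<dots> = (r + 1) choose 2" using r2 binomial_symmetric[of "r - 1" "r + 1"] by simp
    finally have "card {\<eta> \<in> H. \<eta> \<subseteq> F} = (r + 1) * r div 2" by (simp add: choose_two)
    moreover have "even ((r + 1) * r)" by simp
    ultimately have "2 * card {\<eta> \<in> H. \<eta> \<subseteq> F} = (r + 1) * r" by (metis dvd_mult_div_cancel)
    then have "2 * real (card {\<eta> \<in> H. \<eta> \<subseteq> F}) = real ((r + 1) * r)" by (metis of_nat_mult of_nat_numeral)
    then show "2 * (\<Sum>\<eta> | \<eta> \<in> H \<and> \<eta> \<subseteq> F. y F) = real ((r + 1) * r) * y F"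
      by (simp add: mult.assoc[symmetric])
  qed
  finally have "real ((r + 1) * r) * (\<Sum>F\<in>C. y F) < real ((r + 1) * r) * (\<Sum>\<tau>\<in>R. real (min (up_deg \<tau>) q))"
    by (simp only: of_nat_mult mult.assoc sum_distrib_left[symmetric])
  moreover have "0 < real ((r + 1) * r)" using r2 by (simp only: of_nat_0_less_iff) simp
  ultimately have "(\<Sum>F\<in>C. y F) < (\<Sum>\<tau>\<in>R. real (min (up_deg \<tau>) q))"
    using mult_less_cancel_left_pos by blast
  moreover have "(\<Sum>i<k. \<Sum>F\<in>C. (\<Sum>\<tau>\<in>R. b F \<tau> * u i \<tau>)\<^sup>2) = (\<Sum>F\<in>C. y F)"
    unfolding y_def by (rule sum.swap)
  ultimately show ?thesis by simp
qed

end

section \<open>Signs of incidence numbers\<close>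

text \<open>For lists of distinct vertices \<open>rel_sign\<close> is the determinant of a permutation matrix. This makes
  transitivity of relative orientations a product of determinants, and turns the effect of omitting a
  vertex into a Laplace expansion with a single nonzero term.\<close>

definition position_mat :: "'b list \<Rightarrow> 'b list \<Rightarrow> int mat" where
  "position_mat xs ys = mat (length xs) (length ys) (\<lambda>(i, k). of_bool (xs ! i = ys ! k))"

lemma position_mat_carrier [simp]: "length xs = n \<Longrightarrow> length ys = m \<Longrightarrow> position_mat xs ys \<in> carrier_mat n m"
  by (auto simp: position_mat_def)

lemma det_position_mat_permute_list:
  assumes "distinct xs" "p permutes {..<length xs}"
  shows "det (position_mat xs (permute_list p xs)) = sign p"
proof -
  let ?n = "length xs"
  have p: "p permutes {0..<?n}" using assms(2) by (simp add: lessThan_atLeast0)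
  have "position_mat xs (permute_list p xs) = transpose_mat (mat ?n ?n (\<lambda>(i, j). 1\<^sub>m ?n $$ (p i, j)))"
  proof (rule eq_matI)
    fix i k assume "i < dim_row (transpose_mat (mat ?n ?n (\<lambda>(i, j). 1\<^sub>m ?n $$ (p i, j))))"
      "k < dim_col (transpose_mat (mat ?n ?n (\<lambda>(i, j). 1\<^sub>m ?n $$ (p i, j))))"
    then have ik: "i < ?n" "k < ?n" by auto
    then have "p k < ?n" using permutes_in_image[OF assms(2), of k] by simp
    then show "position_mat xs (permute_list p xs) $$ (i, k)
      = transpose_mat (mat ?n ?n (\<lambda>(i, j). 1\<^sub>m ?n $$ (p i, j))) $$ (i, k)"
      using ik assms by (auto simp: position_mat_def permute_list_nth nth_eq_iff_index_eq)
  qed (auto simp: position_mat_def)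
  also have "det \<dots> = det (mat ?n ?n (\<lambda>(i, j). 1\<^sub>m ?n $$ (p i, j)) :: int mat)"
    by (rule det_transpose[of _ ?n]) simp
  also have "\<dots> = sign p" by (subst det_permute_rows[OF _ p]) auto
  finally show ?thesis .
qed

lemma rel_sign_eq_det:
  assumes "distinct xs" "distinct ys" "set xs = set ys"
  shows "rel_sign xs ys = det (position_mat xs ys)"
proof -
  let ?Q = "\<lambda>p. p permutes {..<length xs} \<and> permute_list p xs = ys"
  have "mset ys = mset xs" using assms set_eq_iff_mset_eq_distinct by blast
  then have ex: "\<exists>p. ?Q p" by (metis mset_eq_permutation)
  then have "?Q (SOME p. ?Q p)" by (rule someI_ex)
  then have "sign (SOME p. ?Q p) = det (position_mat xs ys)"
    using det_position_mat_permute_list[OF assms(1), of "SOME p. ?Q p"] by simp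
  then show ?thesis using ex by (simp add: rel_sign_def)
qed

lemma rel_sign_eq_0: "set xs \<noteq> set ys \<Longrightarrow> rel_sign xs ys = 0"
  unfolding rel_sign_def by (metis set_permute_list)

lemma rel_sign_square:
  assumes "distinct xs" "distinct ys" "set xs = set ys"
  shows "(rel_sign xs ys)\<^sup>2 = 1"
proof -
  have "mset ys = mset xs" using assms set_eq_iff_mset_eq_distinct by blast
  then have ex: "\<exists>p. p permutes {..<length xs} \<and> permute_list p xs = ys" by (metis mset_eq_permutation)
  then show ?thesis by (simp add: rel_sign_def sign_def)
qed

lemma rel_sign_trans:
  assumes "distinct xs" "distinct ys" "distinct zs" "set xs = set ys" "set ys = set zs"
  shows "rel_sign xs ys * rel_sign ys zs = rel_sign xs zs"
proof -
  have len: "length ys = length xs" "length zs = length xs" using assms distinct_card by metis+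
  have "position_mat xs ys * position_mat ys zs = position_mat xs zs"
  proof (rule eq_matI)
    fix i k assume "i < dim_row (position_mat xs zs)" "k < dim_col (position_mat xs zs)"
    then have ik: "i < length xs" "k < length xs" by (auto simp: position_mat_def len)
    then obtain l where l: "l < length xs" "ys ! l = xs ! i" using assms(4) len by (metis in_set_conv_nth)
    have "(position_mat xs ys * position_mat ys zs) $$ (i, k)
      = (\<Sum>j = 0..<length xs. of_bool (xs ! i = ys ! j) * of_bool (ys ! j = zs ! k))"
      using ik by (simp add: position_mat_def len scalar_prod_def)
    also have "\<dots> = (\<Sum>j = 0..<length xs. if j = l then of_bool (xs ! i = zs ! k) else 0)"
    proof (intro sum.cong refl)
      fix j assume "j \<in> {0..<length xs}"
      then have "xs ! i = ys ! j \<longleftrightarrow> j = l"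
        using l assms(2) len by (metis atLeastLessThan_iff nth_eq_iff_index_eq)
      then show "of_bool (xs ! i = ys ! j) * of_bool (ys ! j = zs ! k)
          = (if j = l then of_bool (xs ! i = zs ! k) else (0::int))" by auto
    qed
    also have "\<dots> = position_mat xs zs $$ (i, k)" using l ik by (simp add: position_mat_def len)
    finally show "(position_mat xs ys * position_mat ys zs) $$ (i, k) = position_mat xs zs $$ (i, k)" .
  qed (auto simp: position_mat_def)
  then have "det (position_mat xs zs) = det (position_mat xs ys) * det (position_mat ys zs)"
    by (metis det_mult[of _ "length xs"] position_mat_carrier len)
  then show ?thesis using assms by (simp add: rel_sign_eq_det)
qed

lemma nth_delete: "i < length xs - 1 \<Longrightarrow> j < length xs \<Longrightarrow>
    (take j xs @ drop (Suc j) xs) ! i = xs ! (if i < j then i else Suc i)"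
  by (auto simp: nth_append)

lemma set_delete_nth:
  assumes "distinct xs" "j < length xs"
  shows "set (take j xs @ drop (Suc j) xs) = set xs - {xs ! j}"
proof -
  have "xs = take j xs @ xs ! j # drop (Suc j) xs" using assms(2) by (rule id_take_nth_drop)
  then have "set xs = insert (xs ! j) (set (take j xs @ drop (Suc j) xs))"
    "xs ! j \<notin> set (take j xs @ drop (Suc j) xs)"
    using assms(1) by (metis Un_insert_right list.simps(15) set_append,
      metis (no_types, lifting) distinct_append distinct.simps(2) Un_iff disjoint_iff list.set_intros(1) set_append)
  then show ?thesis by auto
qed

lemma distinct_delete_nth: "distinct xs \<Longrightarrow> distinct (take j xs @ drop (Suc j) xs)"
  by (metis distinct_append distinct_take distinct_drop disjoint_iff append_take_drop_id
      set_take_disj_set_drop_if_distinct lessI order.strict_implies_order)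

lemma rel_sign_delete:
  assumes "distinct xs" "distinct ys" "set xs = set ys" "j < length xs" "k < length ys" "xs ! j = ys ! k"
  shows "rel_sign (take j xs @ drop (Suc j) xs) (take k ys @ drop (Suc k) ys) = (- 1) ^ (j + k) * rel_sign xs ys"
proof -
  have len: "length ys = length xs" using assms distinct_card by metis
  let ?xs = "take j xs @ drop (Suc j) xs" and ?ys = "take k ys @ drop (Suc k) ys"
  have "det (position_mat xs ys) = (\<Sum>l<length xs. position_mat xs ys $$ (j, l) * cofactor (position_mat xs ys) j l)"
    by (rule laplace_expansion_row) (use assms len in auto)
  also have "\<dots> = (\<Sum>l<length xs. if l = k then cofactor (position_mat xs ys) j k else 0)"
    using assms len by (intro sum.cong refl) (auto simp: position_mat_def nth_eq_iff_index_eq)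
  also have "\<dots> = cofactor (position_mat xs ys) j k" using assms len by simp
  also have "mat_delete (position_mat xs ys) j k = position_mat ?xs ?ys"
    using assms(4,5) len
    by (intro eq_matI) (auto simp: mat_delete_def position_mat_def nth_delete simp del: nth_append)
  then have "cofactor (position_mat xs ys) j k = (- 1) ^ (j + k) * det (position_mat ?xs ?ys)"
    by (simp add: cofactor_def)
  finally have "rel_sign xs ys = (- 1) ^ (j + k) * rel_sign ?xs ?ys"
    using assms len
    by (simp add: rel_sign_eq_det distinct_delete_nth set_delete_nth del: set_append distinct_append)
  then show ?thesis by (simp add: mult.assoc[symmetric] power_add[symmetric])
qed

text \<open>The second part says that composing the incidence of \<open>\<tau>\<close> in \<open>F\<close> with a reference order \<open>e\<close> of \<open>\<tau>\<close> amounts to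
  putting the omitted vertex \<open>v\<close> in front; the orientation chosen for \<open>\<tau>\<close> cancels.\<close>

lemma incidence_codim1:
  assumes ori: "distinct (ori F)" "set (ori F) = F" "distinct (ori \<tau>)" "set (ori \<tau>) = \<tau>"
    and v: "v \<in> F" "\<tau> = F - {v}"
  shows "(incidence ori F \<tau>)\<^sup>2 = 1"
    and "distinct e \<Longrightarrow> set e = \<tau> \<Longrightarrow> incidence ori F \<tau> * rel_sign (ori \<tau>) e = rel_sign (ori F) (v # e)"
proof -
  let ?xs = "ori F"
  obtain j where j: "j < length ?xs" "?xs ! j = v" using v ori by (metis in_set_conv_nth)
  have "incidence ori F \<tau> = (\<Sum>i<length ?xs. if i = j then (- 1) ^ j * rel_sign (take j ?xs @ drop (Suc j) ?xs) (ori \<tau>) else 0)"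
    unfolding incidence_def
  proof (intro sum.cong refl)
    fix i assume i: "i \<in> {..<length ?xs}"
    show "(- 1) ^ i * rel_sign (take i ?xs @ drop (Suc i) ?xs) (ori \<tau>)
        = (if i = j then (- 1) ^ j * rel_sign (take j ?xs @ drop (Suc j) ?xs) (ori \<tau>) else 0)"
    proof (cases "i = j")
      case False
      then have "?xs ! i \<noteq> v" using i j ori by (auto simp: nth_eq_iff_index_eq)
      then have "set (take i ?xs @ drop (Suc i) ?xs) \<noteq> set (ori \<tau>)"
        using i ori v by (subst set_delete_nth) auto
      then show ?thesis using False by (simp add: rel_sign_eq_0)
    qed simp
  qed
  then have inc: "incidence ori F \<tau> = (- 1) ^ j * rel_sign (take j ?xs @ drop (Suc j) ?xs) (ori \<tau>)"
    using j by simp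
  have del: "distinct (take j ?xs @ drop (Suc j) ?xs)" "set (take j ?xs @ drop (Suc j) ?xs) = \<tau>"
    using set_delete_nth[OF ori(1) j(1)] distinct_delete_nth[OF ori(1)] v ori j by auto
  show "(incidence ori F \<tau>)\<^sup>2 = 1"
    using rel_sign_square[OF del(1) ori(3)] del ori by (simp add: inc power_mult_distrib power_even_eq[symmetric] flip: power_mult)
  assume e: "distinct e" "set e = \<tau>"
  have "incidence ori F \<tau> * rel_sign (ori \<tau>) e = (- 1) ^ j * rel_sign (take j ?xs @ drop (Suc j) ?xs) e"
    using rel_sign_trans[OF del(1) ori(3) e(1)] del(2) ori e by (simp add: inc mult.assoc)
  also have "\<dots> = rel_sign ?xs (v # e)"
    using rel_sign_delete[of ?xs "v # e" j 0] ori e v j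
    by (simp add: insert_absorb mult.assoc[symmetric] power_add[symmetric])
  finally show "incidence ori F \<tau> * rel_sign (ori \<tau>) e = rel_sign ?xs (v # e)" .
qed

lemma incidence_not_face:
  assumes "distinct (ori F)" "set (ori F) = F" "set (ori \<tau>) = \<tau>" "\<not> \<tau> \<subseteq> F"
  shows "incidence ori F \<tau> = 0"
  unfolding incidence_def
proof (intro sum.neutral ballI)
  fix j assume "j \<in> {..<length (ori F)}"
  then have "set (take j (ori F) @ drop (Suc j) (ori F)) \<noteq> set (ori \<tau>)"
    using assms by (subst set_delete_nth) auto
  then show "(- 1) ^ j * rel_sign (take j (ori F) @ drop (Suc j) (ori F)) (ori \<tau>) = 0"
    by (simp add: rel_sign_eq_0)
qed

lemma rel_sign_refl: "distinct xs \<Longrightarrow> rel_sign xs xs = 1"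
proof -
  assume d: "distinct xs"
  have "rel_sign xs xs * rel_sign xs xs = rel_sign xs xs" "(rel_sign xs xs)\<^sup>2 = 1"
    using rel_sign_trans[OF d d d] rel_sign_square[OF d d] by auto
  then show ?thesis by (auto simp: power2_eq_square)
qed

lemma rel_sign_swap:
  assumes "distinct (x # y # e)"
  shows "rel_sign (x # y # e) (y # x # e) = - 1"
  using rel_sign_delete[of "x # y # e" "y # x # e" 0 1] assms rel_sign_refl[of "y # e"]
  by (auto simp: insert_commute)

text \<open>The two ways from \<open>F\<close> down to \<open>e\<close> put the omitted vertices \<open>x\<close> and \<open>y\<close> in front of \<open>e\<close> in opposite
  orders, which differ by one transposition.\<close>

lemma boundary_square_zero:
  assumes ori: "\<And>\<sigma>. \<sigma> \<in> {F, insert x (set e), insert y (set e)} \<Longrightarrow> distinct (ori \<sigma>) \<and> set (ori \<sigma>) = \<sigma>"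
    and xy: "distinct (x # y # e)" and F: "F = insert x (insert y (set e))"
  shows "incidence ori F (insert x (set e)) * rel_sign (ori (insert x (set e))) (x # e)
    + incidence ori F (insert y (set e)) * rel_sign (ori (insert y (set e))) (y # e) = 0"
proof -
  have "incidence ori F (insert x (set e)) * rel_sign (ori (insert x (set e))) (x # e) = rel_sign (ori F) (y # x # e)"
    by (rule incidence_codim1(2)) (use ori xy F in auto)
  moreover have "incidence ori F (insert y (set e)) * rel_sign (ori (insert y (set e))) (y # e) = rel_sign (ori F) (x # y # e)"
    by (rule incidence_codim1(2)) (use ori xy F in auto)
  moreover have "rel_sign (ori F) (x # y # e) * rel_sign (x # y # e) (y # x # e) = rel_sign (ori F) (y # x # e)"
    by (rule rel_sign_trans) (use ori xy F in auto)
  ultimately show ?thesis using rel_sign_swap[OF xy] by simp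
qed

section \<open>Diagonalisation of real symmetric matrices\<close>

text \<open>The average over \<open>I\<close> of \<open>\<Sum>i<k. (u i x)\<^sup>2\<close> is \<open>k / card I < 1\<close>, so some unit coordinate vector is not
  in the span of the frame; its normalised residual is the new vector.\<close>

lemma orthonormal_extend:
  assumes "finite I" "orthonormal_on I k u" "k < card I"
  obtains w where "(\<Sum>x\<in>I. (w x)\<^sup>2) = 1" "\<And>j. j < k \<Longrightarrow> (\<Sum>x\<in>I. w x * u j x) = 0"
proof -
  have "(\<Sum>x\<in>I. \<Sum>i<k. (u i x)\<^sup>2) = (\<Sum>i<k. \<Sum>x\<in>I. u i x * u i x)"
    by (subst sum.swap) (simp add: power2_eq_square)
  also have "\<dots> = real k" using assms(2) by (simp add: orthonormal_on_def)
  finally have "(\<Sum>x\<in>I. \<Sum>i<k. (u i x)\<^sup>2) < (\<Sum>x\<in>I. 1)" using assms(3) by simp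
  then obtain z where z: "z \<in> I" "(\<Sum>i<k. (u i z)\<^sup>2) < 1"
    by (meson not_le sum_mono)
  define f where "f x = (of_bool (x = z) :: real)" for x
  define g where "g x = f x - (\<Sum>i<k. (\<Sum>y\<in>I. f y * u i y) * u i x)" for x
  have f: "(\<Sum>y\<in>I. f y * h y) = h z" for h
    using z(1) assms(1) by (simp add: f_def)
  have "(\<Sum>x\<in>I. (f x)\<^sup>2) = 1" using f[of f] by (simp add: power2_eq_square f_def)
  then have "(\<Sum>x\<in>I. (g x)\<^sup>2) \<noteq> 0"
    using orthonormal_residual[OF assms(2), of f] z(2) unfolding g_def f by simp
  then obtain c where c: "c \<noteq> 0" "(\<Sum>x\<in>I. (g x / c)\<^sup>2) = 1" by (rule normalize_on)
  show thesis
  proof (rule that[of "\<lambda>x. g x / c"])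
    show "(\<Sum>x\<in>I. (g x / c)\<^sup>2) = 1" by fact
    show "(\<Sum>x\<in>I. g x / c * u j x) = 0" if "j < k" for j
      using residual_orthogonal[OF assms(2) that, of f]
      by (simp add: g_def sum_divide_distrib[symmetric])
  qed
qed

text \<open>Functions vanish outside of \<open>I\<close> here, so that this unit sphere is a closed subset of a product of
  compact intervals.\<close>

lemma compact_unit_sphere_on:
  fixes u :: "nat \<Rightarrow> 'b \<Rightarrow> real"
  assumes "finite I"
  shows "compact {x. (\<forall>i. i \<notin> I \<longrightarrow> x i = 0) \<and> (\<Sum>i\<in>I. (x i)\<^sup>2) = 1 \<and> (\<forall>j<k. (\<Sum>i\<in>I. x i * u j i) = 0)}"
    (is "compact ?K")
proof -
  define box where "box = PiE UNIV (\<lambda>i. if i \<in> I then {-1..1} else {0::real})"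
  have "compactin (product_topology (\<lambda>i. euclidean) UNIV) box"
    unfolding box_def compactin_PiE by (auto simp: compactin_euclidean_iff)
  then have box: "compact box"
    by (simp add: euclidean_product_topology compactin_euclidean_iff)
  have sq: "closed {x. (\<Sum>i\<in>I. (x i)\<^sup>2) = (1::real)}"
    by (intro closed_Collect_eq continuous_intros continuous_on_product_coordinates)
  have orth: "closed {x. (\<Sum>i\<in>I. x i * u j i) = 0}" for j
    by (intro closed_Collect_eq continuous_intros continuous_on_product_coordinates)
  have "compact (box \<inter> ({x. (\<Sum>i\<in>I. (x i)\<^sup>2) = 1} \<inter> (\<Inter>j\<in>{..<k}. {x. (\<Sum>i\<in>I. x i * u j i) = 0})))"
    by (intro compact_Int_closed box closed_Int sq closed_INT ballI orth)
  also have "box \<inter> ({x. (\<Sum>i\<in>I. (x i)\<^sup>2) = 1} \<inter> (\<Inter>j\<in>{..<k}. {x. (\<Sum>i\<in>I. x i * u j i) = 0})) = ?K"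
  proof -
    have "\<bar>x i\<bar> \<le> 1" if "(\<Sum>i\<in>I. (x i)\<^sup>2) = 1" "i \<in> I" for x :: "'b \<Rightarrow> real" and i
      using member_le_sum[OF that(2), of "\<lambda>i. (x i)\<^sup>2"] that assms
      by (simp add: abs_square_le_1)
    then have "- 1 \<le> x i \<and> x i \<le> 1" if "(\<Sum>i\<in>I. (x i)\<^sup>2) = 1" "i \<in> I" for x :: "'b \<Rightarrow> real" and i
      using that by (metis abs_le_iff minus_le_iff)
    then show ?thesis by (auto simp: box_def PiE_def Pi_def split: if_splits)
  qed
  finally show ?thesis .
qed

text \<open>First-order condition at a maximum: in \<open>spectral_frame\<close> the quadratic in \<open>t\<close> is the change of a
  quadratic form along a line through its maximiser.\<close>

lemma linear_coeff_zero:
  fixes a b :: real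
  assumes "\<And>t. 2 * a * t + b * t\<^sup>2 \<le> 0"
  shows "a = 0"
proof (rule ccontr)
  assume a: "a \<noteq> 0"
  define M where "M = 1 + \<bar>b\<bar>"
  have M: "M > 0" "b \<ge> - M" "\<bar>b\<bar> < M" by (auto simp: M_def)
  have "2 * a * (a / M) + b * (a / M)\<^sup>2 = (a\<^sup>2 / M) * (2 + b / M)"
    using M by (simp add: power2_eq_square field_simps)
  moreover have "b / M \<ge> -1" using M by (simp add: field_simps)
  then have "(a\<^sup>2 / M) * (2 + b / M) > 0" using a M by (intro mult_pos_pos) auto
  ultimately show False using assms[of "a / M"] by simp
qed

text \<open>The next eigenvector is a maximiser \<open>v\<close> of the quadratic form \<open>B\<close> of \<open>A\<close> on the unit sphere of the
  orthogonal complement of the eigenvectors found so far. The first-order condition gives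
  \<open>B v h = M * ip v h\<close> for \<open>h\<close> in that complement. It extends to all \<open>h\<close> because \<open>A\<close> maps the span of the earlier
  eigenvectors to itself.\<close>

lemma spectral_frame:
  fixes A :: "'b \<Rightarrow> 'b \<Rightarrow> real"
  assumes fin: "finite I" and sym: "\<And>x y. A x y = A y x"
  shows "k \<le> card I \<Longrightarrow> \<exists>u \<mu>. orthonormal_on I k u \<and>
     (\<forall>i<k. \<forall>x\<in>I. (\<Sum>y\<in>I. A x y * u i y) = \<mu> i * u i x)"
proof (induction k)
  case 0
  then show ?case by (simp add: orthonormal_on_def)
next
  case (Suc k)
  then obtain u \<mu> where u: "orthonormal_on I k u"
    and eig: "\<And>i x. i < k \<Longrightarrow> x \<in> I \<Longrightarrow> (\<Sum>y\<in>I. A x y * u i y) = \<mu> i * u i x" by auto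
  define K where "K = {x. (\<forall>i. i \<notin> I \<longrightarrow> x i = 0) \<and> (\<Sum>i\<in>I. (x i)\<^sup>2) = 1 \<and> (\<forall>j<k. (\<Sum>i\<in>I. x i * u j i) = 0)}"
  define B where "B f g = (\<Sum>x\<in>I. \<Sum>y\<in>I. A x y * f x * g y)" for f g :: "'b \<Rightarrow> real"
  define ip where "ip f g = (\<Sum>x\<in>I. f x * g x)" for f g :: "'b \<Rightarrow> real"
  have B_sym: "B f g = B g f" for f g
    unfolding B_def by (subst sum.swap) (simp add: sym mult_ac)
  have B_add: "B (\<lambda>x. f x + t * h x) g = B f g + t * B h g" for f h g t
    by (simp add: B_def algebra_simps sum.distrib sum_distrib_left)
  have B_add': "B g (\<lambda>x. f x + t * h x) = B g f + t * B g h" for f h g t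
    by (simp add: B_def algebra_simps sum.distrib sum_distrib_left)
  have ip_sym: "ip f g = ip g f" for f g by (simp add: ip_def mult_ac)
  have ip_add: "ip (\<lambda>x. f x + t * h x) g = ip f g + t * ip h g" for f h g t
    by (simp add: ip_def algebra_simps sum.distrib sum_distrib_left)
  have ip_add': "ip g (\<lambda>x. f x + t * h x) = ip g f + t * ip g h" for f h g t
    by (simp add: ip_def algebra_simps sum.distrib sum_distrib_left)
  have "compact K" unfolding K_def by (rule compact_unit_sphere_on[OF fin])
  moreover have "K \<noteq> {}"
  proof -
    obtain w where w: "(\<Sum>x\<in>I. (w x)\<^sup>2) = 1" "\<And>j. j < k \<Longrightarrow> (\<Sum>x\<in>I. w x * u j x) = 0"
      using orthonormal_extend[OF fin u] Suc.prems by (metis Suc_le_lessD)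
    then have "(\<lambda>x. if x \<in> I then w x else 0) \<in> K" by (simp add: K_def)
    then show ?thesis by blast
  qed
  moreover have "continuous_on K (\<lambda>f. B f f)"
    unfolding B_def
    by (intro continuous_intros continuous_on_subset[OF continuous_on_product_coordinates]) auto
  ultimately obtain v where v: "v \<in> K" and max: "\<And>f. f \<in> K \<Longrightarrow> B f f \<le> B v v"
    using continuous_attains_sup[of K "\<lambda>f. B f f"] by metis
  have v1: "ip v v = 1" and vu: "\<And>j. j < k \<Longrightarrow> ip v (u j) = 0"
    using v by (auto simp: K_def ip_def power2_eq_square)
  define M where "M = B v v"
  have le: "B f f \<le> M * ip f f" if orth: "\<And>j. j < k \<Longrightarrow> ip f (u j) = 0" for f
  proof (cases "ip f f = 0")
    case True
    then have "\<forall>x\<in>I. f x = 0"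
      using fin unfolding ip_def by (subst (asm) sum_nonneg_eq_0_iff) auto
    then have "B f f = 0" by (simp add: B_def)
    then show ?thesis using True by simp
  next
    case False
    have pos: "ip f f > 0" using False sum_nonneg[of I "\<lambda>x. f x * f x"] by (auto simp: ip_def)
    define s where "s = sqrt (ip f f)"
    have s: "s > 0" "s * s = ip f f" using pos by (auto simp: s_def)
    define g where "g x = (if x \<in> I then f x / s else 0)" for x
    have "(\<Sum>i\<in>I. (g i)\<^sup>2) = 1"
      using s by (simp add: g_def power_divide sum_divide_distrib[symmetric])
         (simp add: ip_def power2_eq_square)
    moreover have "(\<Sum>i\<in>I. g i * u j i) = 0" if "j < k" for j
      using orth[OF that] by (simp add: g_def ip_def sum_divide_distrib[symmetric])
    ultimately have "g \<in> K" by (simp add: K_def g_def)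
    then have "B g g \<le> M" unfolding M_def by (rule max)
    moreover have "B g g = B f f / (s * s)"
      by (simp add: B_def g_def sum_divide_distrib)
    ultimately show ?thesis using s pos by (simp add: field_simps)
  qed
  have crit: "B v h = M * ip v h" if "\<And>j. j < k \<Longrightarrow> ip h (u j) = 0" for h
  proof -
    have "2 * (B v h - M * ip v h) * t + (B h h - M * ip h h) * t\<^sup>2 \<le> 0" for t
    proof -
      have "ip (\<lambda>x. v x + t * h x) (u j) = 0" if "j < k" for j
        using vu that \<open>\<And>j. j < k \<Longrightarrow> ip h (u j) = 0\<close> by (simp add: ip_add)
      from le[OF this] show ?thesis
        using v1 by (simp add: B_add B_add' ip_add ip_add' B_sym[of h v] ip_sym[of h v] M_def[symmetric]
          algebra_simps power2_eq_square)
    qed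
    then show ?thesis using linear_coeff_zero by fastforce
  qed
  have Bu: "B f (u j) = \<mu> j * ip f (u j)" if "j < k" for f j
  proof -
    have "B f (u j) = (\<Sum>x\<in>I. f x * (\<Sum>y\<in>I. A x y * u j y))"
      by (simp add: B_def sum_distrib_left mult_ac)
    then show ?thesis using eig[OF that] by (simp add: ip_def sum_distrib_left mult_ac)
  qed
  have all: "B v f = M * ip v f" for f
  proof -
    define h where "h x = f x - (\<Sum>i<k. (\<Sum>y\<in>I. f y * u i y) * u i x)" for x
    have "ip h (u j) = 0" if "j < k" for j
      unfolding ip_def h_def by (rule residual_orthogonal[OF u that])
    then have h: "B v h = M * ip v h" by (rule crit)
    have sp: "B v (\<lambda>x. \<Sum>i<k. c i * u i x) = 0 \<and> ip v (\<lambda>x. \<Sum>i<k. c i * u i x) = 0" for c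
    proof -
      have 1: "ip v (\<lambda>x. \<Sum>i<k. c i * u i x) = 0"
        unfolding ip_def sum_swap_inner using vu by (simp add: ip_def)
      have B_col: "(\<Sum>y\<in>I. (\<Sum>x\<in>I. A x y * v x) * g y) = B v g" for g
        unfolding B_def sum_distrib_right by (rule sum.swap)
      have "B v (\<lambda>x. \<Sum>i<k. c i * u i x) = (\<Sum>i<k. c i * B v (u i))"
        unfolding B_col[symmetric] by (rule sum_swap_inner)
      also have "\<dots> = 0" using Bu vu by simp
      finally show ?thesis using 1 by simp
    qed
    define p where "p x = (\<Sum>i<k. (\<Sum>y\<in>I. f y * u i y) * u i x)" for x
    have p: "B v p = 0" "ip v p = 0" using sp unfolding p_def by auto
    have f: "f = (\<lambda>x. h x + 1 * p x)" by (simp add: h_def p_def)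
    have "B v f = B v h" by (subst f, subst B_add') (simp add: p)
    moreover have "ip v f = ip v h" by (subst f, subst ip_add') (simp add: p)
    ultimately show ?thesis using h by simp
  qed
  have eigv: "(\<Sum>y\<in>I. A x y * v y) = M * v x" if "x \<in> I" for x
  proof -
    have 1: "B v (\<lambda>y. of_bool (y = x)) = (\<Sum>y\<in>I. A x y * v y)"
      using fin that by (simp add: B_def sym)
    have 2: "ip v (\<lambda>y. of_bool (y = x)) = v x"
      using fin that by (simp add: ip_def)
    show ?thesis using all[of "\<lambda>y. of_bool (y = x)"] unfolding 1 2 .
  qed
  have "orthonormal_on I (Suc k) (u(k := v))"
    using v vu by (intro orthonormal_on_snoc[OF u]) (auto simp: K_def)
  moreover have "(\<Sum>y\<in>I. A x y * (u(k := v)) i y) = (\<mu>(k := M)) i * (u(k := v)) i x"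
    if "i < Suc k" "x \<in> I" for i x
    using that eig eigv by (cases "i = k") auto
  ultimately show ?case by blast
qed

section \<open>Eigenvalues and rank of a Gram matrix\<close>

text \<open>By Bessel each of the \<open>card I\<close> numbers \<open>\<Sum>i. (u i x)\<^sup>2\<close> is at most 1, while their sum is
  \<open>card I\<close>. So all of them are 1, and the coordinate vectors have residual zero.\<close>

lemma orthonormal_complete:
  assumes fin: "finite I" and u: "orthonormal_on I (card I) u" and xy: "x \<in> I" "y \<in> I"
  shows "(\<Sum>i<card I. u i x * u i y) = of_bool (x = y)"
proof -
  define f where "f z y = (of_bool (y = z) :: real)" for z y :: 'a
  have f: "(\<Sum>y\<in>I. f z y * h y) = h z" if "z \<in> I" for h z
    using that fin by (simp add: f_def)
  have norm1: "(\<Sum>y\<in>I. (f z y)\<^sup>2) = 1" if "z \<in> I" for z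
    using f[OF that, of "f z"] by (simp add: power2_eq_square f_def)
  have le: "(\<Sum>i<card I. (u i z)\<^sup>2) \<le> 1" if "z \<in> I" for z
    using bessel[OF u, of "f z"] f[OF that] norm1[OF that] by simp
  have "(\<Sum>z\<in>I. \<Sum>i<card I. (u i z)\<^sup>2) = (\<Sum>i<card I. \<Sum>z\<in>I. u i z * u i z)"
    by (subst sum.swap) (simp add: power2_eq_square)
  also have "\<dots> = (\<Sum>z\<in>I. 1)" using u by (simp add: orthonormal_on_def)
  finally have "(\<Sum>z\<in>I. 1 - (\<Sum>i<card I. (u i z)\<^sup>2)) = 0" by (simp add: sum_subtractf)
  then have eq1: "(\<Sum>i<card I. (u i x)\<^sup>2) = 1"
    using le fin xy by (subst (asm) sum_nonneg_eq_0_iff) auto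
  have "(\<Sum>z\<in>I. (f x z - (\<Sum>i<card I. u i x * u i z))\<^sup>2) = 0"
    using orthonormal_residual[OF u, of "f x"] f[OF xy(1)] norm1[OF xy(1)] eq1 by simp
  then have "f x y - (\<Sum>i<card I. u i x * u i y) = 0"
    using fin xy by (subst (asm) sum_nonneg_eq_0_iff) auto
  then show ?thesis by (auto simp: f_def)
qed

lemma orthonormal_expansion:
  assumes fin: "finite I" and u: "orthonormal_on I (card I) u" and x: "x \<in> I"
  shows "(\<Sum>i<card I. (\<Sum>y\<in>I. f y * u i y) * u i x) = f x"
proof -
  have "(\<Sum>i<card I. (\<Sum>y\<in>I. f y * u i y) * u i x) = (\<Sum>y\<in>I. f y * (\<Sum>i<card I. u i x * u i y))"
    unfolding sum_swap_inner by (simp add: mult.commute)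
  also have "\<dots> = (\<Sum>y\<in>I. if y = x then f y else 0)"
    using orthonormal_complete[OF fin u x] by (intro sum.cong refl) auto
  finally show ?thesis using fin x by simp
qed

lemma parseval:
  assumes fin: "finite I" and u: "orthonormal_on I (card I) u"
  shows "(\<Sum>i<card I. (\<Sum>x\<in>I. f x * u i x)\<^sup>2) = (\<Sum>x\<in>I. (f x)\<^sup>2)"
  using orthonormal_on_norm[OF u, of "\<lambda>i. \<Sum>x\<in>I. f x * u i x", symmetric]
    orthonormal_expansion[OF fin u, of _ f] by simp

lemma proots_prod_linear: "proots (\<Prod>a\<leftarrow>as. [:- a, 1:]) = mset (as :: real list)"
proof (induction as)
  case (Cons a as)
  have "(\<Prod>a\<leftarrow>as. [:- a, 1:]) \<noteq> (0 :: real poly)" by (auto simp: prod_list_zero_iff)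
  then show ?case using Cons by (simp add: proots_mult del: mult_pCons_left)
qed simp

text \<open>An orthonormal eigenbasis makes \<open>A\<close> similar to a diagonal matrix, which identifies the roots of the
  characteristic polynomial with the eigenvalues of the basis vectors. A permutation then sorts the basis
  in the order of \<open>eigval_list\<close>.\<close>

lemma eigval_list_eigenvectors:
  fixes A :: "real mat"
  assumes A: "A \<in> carrier_mat n n" and sym: "\<And>x y. x < n \<Longrightarrow> y < n \<Longrightarrow> A $$ (x, y) = A $$ (y, x)"
  obtains u where "length (eigval_list A) = n" "orthonormal_on {..<n} n u"
    "\<And>i x. i < n \<Longrightarrow> x < n \<Longrightarrow> (\<Sum>y<n. A $$ (x, y) * u i y) = eigval_list A ! i * u i x"
proof -
  define A' where "A' x y = (if x < n \<and> y < n then A $$ (x, y) else 0)" for x y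
  have A'_sym: "A' x y = A' y x" for x y using sym by (auto simp: A'_def)
  have "\<exists>w \<mu>. orthonormal_on {..<n} n w \<and> (\<forall>i<n. \<forall>x\<in>{..<n}. (\<Sum>y<n. A' x y * w i y) = \<mu> i * w i x)"
    by (rule spectral_frame) (use A'_sym in auto)
  then obtain w \<mu> where w: "orthonormal_on {..<n} n w"
    and eig': "\<And>i x. i < n \<Longrightarrow> x \<in> {..<n} \<Longrightarrow> (\<Sum>y<n. A' x y * w i y) = \<mu> i * w i x"
    by blast
  have eig: "(\<Sum>y<n. A $$ (x, y) * w i y) = \<mu> i * w i x" if "i < n" "x < n" for i x
    using eig'[of i x] that by (simp add: A'_def)
  have comp: "(\<Sum>i<n. w i x * w i y) = of_bool (x = y)" if "x < n" "y < n" for x y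
    using orthonormal_complete[of "{..<n}" w x y] w that by simp
  define U where "U = mat n n (\<lambda>(x, i). w i x)"
  define D where "D = mat n n (\<lambda>(i, j). if i = j then \<mu> i else 0)"
  have car: "U \<in> carrier_mat n n" "D \<in> carrier_mat n n" by (auto simp: U_def D_def)
  have UD: "(U * D) $$ (x, i) = \<mu> i * w i x" if "x < n" "i < n" for x i
  proof -
    have "(U * D) $$ (x, i) = (\<Sum>l = 0..<n. w l x * (if l = i then \<mu> l else 0))"
      using that by (simp add: U_def D_def scalar_prod_def)
    also have "\<dots> = (\<Sum>l = 0..<n. if l = i then \<mu> i * w i x else 0)"
      by (intro sum.cong refl) auto
    finally show ?thesis using that by simp
  qed
  have "similar_mat A D"
  proof (rule similar_matI[of _ _ U "transpose_mat U"])
    show "{A, D, U, transpose_mat U} \<subseteq> carrier_mat n n" using A car by auto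
    show "U * transpose_mat U = 1\<^sub>m n"
      by (rule eq_matI) (auto simp: U_def scalar_prod_def comp lessThan_atLeast0[symmetric])
    show "transpose_mat U * U = 1\<^sub>m n"
      using orthonormal_onD[OF w]
      by (intro eq_matI) (auto simp: U_def scalar_prod_def lessThan_atLeast0[symmetric])
    show "A = U * D * transpose_mat U"
    proof (rule eq_matI)
      fix x y assume "x < dim_row (U * D * transpose_mat U)" "y < dim_col (U * D * transpose_mat U)"
      then have xy: "x < n" "y < n" using car by auto
      have "(M * transpose_mat U) $$ (x, y) = (\<Sum>i = 0..<n. M $$ (x, i) * w i y)"
        if "M \<in> carrier_mat n n" for M
        using xy that by (simp add: scalar_prod_def U_def)
      from this[of "U * D"] have "(U * D * transpose_mat U) $$ (x, y) = (\<Sum>i = 0..<n. (U * D) $$ (x, i) * w i y)"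
        using car by simp
      also have "\<dots> = (\<Sum>i<n. w i y * (\<Sum>z<n. A $$ (x, z) * w i z))"
        using xy by (intro sum.cong) (auto simp: UD eig)
      also have "\<dots> = (\<Sum>z<n. A $$ (x, z) * (\<Sum>i<n. w i y * w i z))"
        by (rule sum_swap_inner[symmetric])
      also have "\<dots> = (\<Sum>z<n. if z = y then A $$ (x, y) else 0)"
        using xy by (intro sum.cong refl) (auto simp: comp)
      finally show "A $$ (x, y) = (U * D * transpose_mat U) $$ (x, y)" using xy by simp
    qed (use A car in auto)
  qed
  then have "char_poly A = char_poly D" by (rule char_poly_similar)
  also have "\<dots> = (\<Prod>a\<leftarrow>diag_mat D. [:- a, 1:])"
    by (rule char_poly_upper_triangular[OF car(2)]) (auto simp: upper_triangular_def D_def)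
  also have "diag_mat D = map \<mu> [0..<n]" by (auto simp: diag_mat_def D_def)
  finally have "proots (char_poly A) = mset (map \<mu> [0..<n])"
    by (simp only: proots_prod_linear)
  then have ms: "mset (eigval_list A) = mset (map \<mu> [0..<n])"
    by (simp add: eigval_list_def)
  then obtain p where p: "p permutes {..<n}" and e: "permute_list p (map \<mu> [0..<n]) = eigval_list A"
    using mset_eq_permutation[OF ms] by auto
  have pn: "p i < n" if "i < n" for i using permutes_in_image[OF p, of i] that by simp
  have nth: "eigval_list A ! i = \<mu> (p i)" if "i < n" for i
    unfolding e[symmetric] using p pn[OF that] that by (simp add: permute_list_nth)
  show thesis
  proof (rule that[of "\<lambda>i. w (p i)"])
    show "length (eigval_list A) = n" using arg_cong[OF e, of length] by simp
    show "orthonormal_on {..<n} n (\<lambda>i. w (p i))"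
      using w pn permutes_inj[OF p] by (auto simp: orthonormal_on_def inj_eq)
    show "(\<Sum>y<n. A $$ (x, y) * w (p i) y) = eigval_list A ! i * w (p i) x" if "i < n" "x < n" for i x
      using eig[OF pn[OF that(1)] that(2)] nth[OF that(1)] by simp
  qed
qed

lemma eigval_list_decreasing:
  "i \<le> j \<Longrightarrow> j < length (eigval_list A) \<Longrightarrow> eigval_list A ! j \<le> eigval_list A ! i"
  unfolding eigval_list_def
  by (rule sorted_rev_nth_mono) (auto simp: sorted_sorted_list_of_multiset)

lemma gram_eigen:
  fixes B :: "real mat"
  assumes B: "B \<in> carrier_mat n m"
  defines "A \<equiv> B * transpose_mat B"
  shows "\<exists>u. length (eigval_list A) = n \<and> orthonormal_on {..<n} n u \<and>
    (\<forall>i<n. \<forall>x<n. (\<Sum>c<m. B $$ (x, c) * (\<Sum>y<n. B $$ (y, c) * u i y)) = eigval_list A ! i * u i x) \<and>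
    (\<forall>i<n. eigval_list A ! i = (\<Sum>c<m. (\<Sum>x<n. B $$ (x, c) * u i x)\<^sup>2))"
proof -
  have A: "A \<in> carrier_mat n n" using B by (auto simp: A_def)
  have entry: "A $$ (x, y) = (\<Sum>c<m. B $$ (x, c) * B $$ (y, c))" if "x < n" "y < n" for x y
    using that B by (simp add: A_def scalar_prod_def lessThan_atLeast0)
  obtain u where u: "length (eigval_list A) = n" "orthonormal_on {..<n} n u"
    "\<And>i x. i < n \<Longrightarrow> x < n \<Longrightarrow> (\<Sum>y<n. A $$ (x, y) * u i y) = eigval_list A ! i * u i x"
    using eigval_list_eigenvectors[OF A] entry by (metis (no_types, lifting) mult.commute sum.cong)
  have eq: "(\<Sum>c<m. B $$ (x, c) * (\<Sum>y<n. B $$ (y, c) * u i y)) = eigval_list A ! i * u i x"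
    if "i < n" "x < n" for i x
  proof -
    have "(\<Sum>c<m. B $$ (x, c) * (\<Sum>y<n. B $$ (y, c) * u i y))
        = (\<Sum>c<m. \<Sum>y<n. B $$ (x, c) * B $$ (y, c) * u i y)"
      by (simp add: sum_distrib_left mult.assoc)
    also have "\<dots> = (\<Sum>y<n. \<Sum>c<m. B $$ (x, c) * B $$ (y, c) * u i y)" by (rule sum.swap)
    also have "\<dots> = (\<Sum>y<n. A $$ (x, y) * u i y)"
      using that by (simp add: entry sum_distrib_right)
    finally show ?thesis using u(3)[OF that] by simp
  qed
  have val: "eigval_list A ! i = (\<Sum>c<m. (\<Sum>x<n. B $$ (x, c) * u i x)\<^sup>2)" if i: "i < n" for i
  proof -
    define z where "z c = (\<Sum>y<n. B $$ (y, c) * u i y)" for c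
    have "eigval_list A ! i = (\<Sum>x<n. (eigval_list A ! i * u i x) * u i x)"
      using orthonormal_onD[OF u(2) i i] by (simp add: mult.assoc flip: sum_distrib_left)
    also have "\<dots> = (\<Sum>x<n. \<Sum>c<m. z c * (B $$ (x, c) * u i x))"
    proof (intro sum.cong refl)
      fix x assume "x \<in> {..<n}"
      then have "eigval_list A ! i * u i x = (\<Sum>c<m. B $$ (x, c) * z c)"
        using eq[OF i, of x] unfolding z_def by simp
      then show "(eigval_list A ! i * u i x) * u i x = (\<Sum>c<m. z c * (B $$ (x, c) * u i x))"
        by (simp add: sum_distrib_left mult_ac)
    qed
    also have "\<dots> = (\<Sum>c<m. \<Sum>x<n. z c * (B $$ (x, c) * u i x))" by (rule sum.swap)
    also have "\<dots> = (\<Sum>c<m. (\<Sum>x<n. B $$ (x, c) * u i x)\<^sup>2)"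
      by (simp add: power2_eq_square z_def flip: sum_distrib_left)
    finally show "eigval_list A ! i = (\<Sum>c<m. (\<Sum>x<n. B $$ (x, c) * u i x)\<^sup>2)" .
  qed
  show ?thesis using u(1,2) eq val by blast
qed

text \<open>The eigenvectors with nonzero eigenvalue form a basis of the column space of \<open>B\<close>: such an
  eigenvector is a multiple of \<open>B B\<^sup>T u\<close>, and conversely a column of \<open>B\<close> is orthogonal to every eigenvector
  with eigenvalue zero, because there \<open>B\<^sup>T u = 0\<close>.\<close>

lemma mat_rank_eq_card_eigval:
  fixes B :: "real mat"
  assumes B: "B \<in> carrier_mat n m"
  defines "A \<equiv> B * transpose_mat B"
  shows "mat_rank B = card {i. i < n \<and> eigval_list A ! i \<noteq> 0}"
proof -
  obtain u where u: "orthonormal_on {..<n} n u"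
    and eig: "\<And>i x. i < n \<Longrightarrow> x < n \<Longrightarrow> (\<Sum>c<m. B $$ (x, c) * (\<Sum>y<n. B $$ (y, c) * u i y)) = eigval_list A ! i * u i x"
    and val: "\<And>i. i < n \<Longrightarrow> eigval_list A ! i = (\<Sum>c<m. (\<Sum>x<n. B $$ (x, c) * u i x)\<^sup>2)"
    using gram_eigen[OF B, folded A_def] by blast
  define W where "W = {i. i < n \<and> eigval_list A ! i \<noteq> 0}"
  define w where "w i = vec n (u i)" for i
  define S where "S = w ` W"
  interpret vec_space "TYPE(real)" n .
  have Scar: "S \<subseteq> carrier_vec n" by (auto simp: S_def w_def)
  have finS: "finite S" by (simp add: S_def W_def)
  have ww: "(\<Sum>x<n. w i $ x * u j x) = of_bool (i = j)" if "i < n" "j < n" for i j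
    using orthonormal_onD[OF u that] by (simp add: w_def)
  have inj: "inj_on w W"
  proof (rule inj_onI)
    fix i j assume "i \<in> W" "j \<in> W" "w i = w j"
    then have ij: "i < n" "j < n" "w i = w j" by (auto simp: W_def)
    have "of_bool (i = j) = (of_bool (j = j) :: real)"
      unfolding ww[OF ij(1,2), symmetric] ww[OF ij(2,2), symmetric] ij(3) ..
    then show "i = j" by (simp split: if_splits)
  qed
  have lin: "lincomb a S $ x = (\<Sum>i\<in>W. a (w i) * u i x)" if "x < n" for a x
    using that Scar unfolding S_def by (simp add: lincomb_index sum.reindex[OF inj]) (simp add: w_def)
  have "lin_indpt S"
  proof (rule finite_lin_indpt2[OF finS Scar])
    fix a :: "real vec \<Rightarrow> real" assume a: "lincomb a S = 0\<^sub>v n"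
    have "a (w j) = 0" if j: "j \<in> W" for j
    proof -
      have "0 = (\<Sum>x<n. lincomb a S $ x * u j x)" using a by simp
      also have "\<dots> = (\<Sum>x<n. \<Sum>i\<in>W. a (w i) * (u i x * u j x))"
        by (intro sum.cong refl) (simp add: lin sum_distrib_right mult.assoc)
      also have "\<dots> = (\<Sum>i\<in>W. \<Sum>x<n. a (w i) * (u i x * u j x))" by (rule sum.swap)
      also have "\<dots> = (\<Sum>i\<in>W. if i = j then a (w j) else 0)"
        using j orthonormal_onD[OF u] by (intro sum.cong refl) (auto simp: W_def simp flip: sum_distrib_left)
      also have "\<dots> = a (w j)" using j by (simp add: W_def)
      finally show ?thesis by simp
    qed
    then show "\<forall>v\<in>S. a v = 0" by (auto simp: S_def)
  qed
  then have "maximal S (\<lambda>T. T \<subseteq> S \<and> lin_indpt T)" by (auto simp: maximal_def)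
  then have dimS: "vectorspace.dim class_ring (span_vs S) = card S"
    using dim_span[of S S] Scar finS by simp
  have cols: "set (cols B) \<subseteq> carrier_vec n" using B cols_dim by blast
  have "span (set (cols B)) = span S"
  proof
    have "c \<in> span S" if c: "c \<in> set (cols B)" for c
    proof -
      obtain k where k: "k < m" "c = col B k" using c B by (auto simp: cols_def)
      have "lincomb (\<lambda>v. \<Sum>y<n. B $$ (y, k) * v $ y) S = c"
      proof (rule eq_vecI)
        fix x assume "x < dim_vec c"
        then have x: "x < n" using k B by simp
        have z: "(\<Sum>y<n. B $$ (y, k) * u i y) = 0" if "i < n" "i \<notin> W" for i
        proof -
          have "(\<Sum>c<m. (\<Sum>x<n. B $$ (x, c) * u i x)\<^sup>2) = 0" using val[of i] that by (simp add: W_def)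
          then have "\<forall>c\<in>{..<m}. (\<Sum>x<n. B $$ (x, c) * u i x)\<^sup>2 = 0"
            by (subst (asm) sum_nonneg_eq_0_iff) auto
          then show ?thesis using k by auto
        qed
        have "lincomb (\<lambda>v. \<Sum>y<n. B $$ (y, k) * v $ y) S $ x
            = (\<Sum>i\<in>W. (\<Sum>y<n. B $$ (y, k) * u i y) * u i x)"
          using lin[OF x] by (simp add: w_def)
        also have "\<dots> = (\<Sum>i<n. (\<Sum>y<n. B $$ (y, k) * u i y) * u i x)"
          using z by (intro sum.mono_neutral_left) (auto simp: W_def)
        also have "\<dots> = B $$ (x, k)"
          using orthonormal_expansion[of "{..<n}" u x "\<lambda>y. B $$ (y, k)"] u x by simp
        finally show "lincomb (\<lambda>v. \<Sum>y<n. B $$ (y, k) * v $ y) S $ x = c $ x" using k x B by simp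
      qed (use k B Scar lincomb_dim[OF finS Scar] in auto)
      then show ?thesis using finite_span[OF finS] Scar by auto
    qed
    then show "span (set (cols B)) \<subseteq> span S"
      using span_is_subset[of "set (cols B)" "span S"] span_is_submodule[of S] Scar by auto
    have "s \<in> span (set (cols B))" if s: "s \<in> S" for s
    proof -
      obtain i where i: "i < n" "eigval_list A ! i \<noteq> 0" "s = vec n (u i)"
        using s by (auto simp: S_def W_def w_def)
      define v where "v = vec m (\<lambda>c. (\<Sum>y<n. B $$ (y, c) * u i y) / eigval_list A ! i)"
      have "B *\<^sub>v v = s"
      proof (rule eq_vecI)
        fix x assume "x < dim_vec s"
        then have x: "x < n" using i by simp
        have "(B *\<^sub>v v) $ x = (\<Sum>c<m. B $$ (x, c) * ((\<Sum>y<n. B $$ (y, c) * u i y) / eigval_list A ! i))"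
          using x B by (simp add: v_def scalar_prod_def lessThan_atLeast0)
        also have "\<dots> = (\<Sum>c<m. B $$ (x, c) * (\<Sum>y<n. B $$ (y, c) * u i y)) / eigval_list A ! i"
          by (subst sum_divide_distrib) simp
        finally show "(B *\<^sub>v v) $ x = s $ x" using eig[OF i(1) x] i x by simp
      qed (use i B in auto)
      then have "s \<in> col_space B"
        unfolding col_space_eq[OF B] using B i by (auto simp: v_def)
      then show ?thesis by (simp add: col_space_def)
    qed
    then show "span S \<subseteq> span (set (cols B))"
      using span_is_subset[of S "span (set (cols B))"] span_is_submodule[of "set (cols B)"] cols by auto
  qed
  then have "rank B = card S" unfolding rank_def using dimS by simp
  also have "card S = card W" unfolding S_def by (rule card_image[OF inj])
  finally show ?thesis using B by (simp add: mat_rank_def W_def)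
qed

section \<open>The equality case\<close>

lemma sum_nth_eq_sum_set:
  "distinct xs \<Longrightarrow> (\<Sum>i<length xs. f (xs ! i)) = (\<Sum>x\<in>set xs. f x)"
  using sum.reindex_bij_betw[OF bij_betw_nth, of xs "{..<length xs}" "set xs" f] by simp

lemma sum_card_levels_eq_sum_min:
  fixes d :: "'b \<Rightarrow> nat"
  assumes "finite R"
  shows "(\<Sum>i = 1..q. card {\<tau> \<in> R. i \<le> d \<tau>}) = (\<Sum>\<tau>\<in>R. min (d \<tau>) q)"
proof -
  have "(\<Sum>i = 1..q. card {\<tau> \<in> R. i \<le> d \<tau>}) = (\<Sum>i = 1..q. \<Sum>\<tau> | \<tau> \<in> R \<and> i \<le> d \<tau>. 1)" by simp
  also have "\<dots> = (\<Sum>\<tau>\<in>R. \<Sum>i | i \<in> {1..q} \<and> i \<le> d \<tau>. 1)"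
    by (rule sum.swap_restrict) (use assms in auto)
  also have "\<dots> = (\<Sum>\<tau>\<in>R. min (d \<tau>) q)"
  proof (intro sum.cong refl)
    fix \<tau>
    have "{i. i \<in> {1..q} \<and> i \<le> d \<tau>} = {1..min (d \<tau>) q}" by auto
    then show "(\<Sum>i | i \<in> {1..q} \<and> i \<le> d \<tau>. 1) = min (d \<tau>) q" by simp
  qed
  finally show ?thesis .
qed

lemma sum_eigval: "(\<Sum>i = 1..q. eigval A i) = (\<Sum>i<min q (length (eigval_list A)). eigval_list A ! i)"
proof -
  have "(\<Sum>i = 1..q. eigval A i) = (\<Sum>i<q. eigval A (Suc i))"
    by (rule sum.reindex_bij_witness[of _ Suc "\<lambda>i. i - 1"]) auto
  also have "\<dots> = (\<Sum>i<q. if i < length (eigval_list A) then eigval_list A ! i else 0)"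
    by (intro sum.cong refl) (auto simp: eigval_def)
  also have "\<dots> = (\<Sum>i | i \<in> {..<q} \<and> i < length (eigval_list A). eigval_list A ! i)"
    by (rule sum.inter_filter[symmetric]) simp
  also have "{i. i \<in> {..<q} \<and> i < length (eigval_list A)} = {..<min q (length (eigval_list A))}" by auto
  finally show ?thesis .
qed

text \<open>The double sum on the right is the trace of \<open>B B\<^sup>T\<close>. As the eigenvalues are nonnegative and
  decreasing, the part after the first \<open>q\<close> vanishes if and only if at most \<open>q\<close> of them are nonzero.\<close>

lemma sum_first_eigvals_eq_trace_iff:
  fixes B :: "real mat"
  assumes B: "B \<in> carrier_mat n m"
  defines "A \<equiv> B * transpose_mat B"
  shows "(\<Sum>i = 1..q. eigval A i) = (\<Sum>c<m. \<Sum>x<n. (B $$ (x, c))\<^sup>2) \<longleftrightarrow> mat_rank B \<le> q"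
proof -
  define \<mu> where "\<mu> i = eigval_list A ! i" for i
  obtain u where len: "length (eigval_list A) = n" and u: "orthonormal_on {..<n} n u"
    and val: "\<And>i. i < n \<Longrightarrow> \<mu> i = (\<Sum>c<m. (\<Sum>x<n. B $$ (x, c) * u i x)\<^sup>2)"
    using gram_eigen[OF B, folded A_def] unfolding \<mu>_def by blast
  have nonneg: "0 \<le> \<mu> i" if "i < n" for i using val[OF that] by (simp add: sum_nonneg)
  have dec: "\<mu> j \<le> \<mu> i" if "i \<le> j" "j < n" for i j
    unfolding \<mu>_def using eigval_list_decreasing that len by simp
  have rank: "mat_rank B = card {i. i < n \<and> \<mu> i \<noteq> 0}"
    unfolding \<mu>_def A_def by (rule mat_rank_eq_card_eigval[OF B])
  have "(\<Sum>i<n. \<mu> i) = (\<Sum>c<m. \<Sum>i<n. (\<Sum>x<n. B $$ (x, c) * u i x)\<^sup>2)"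
    using val by (subst sum.swap) simp
  also have "\<dots> = (\<Sum>c<m. \<Sum>x<n. (B $$ (x, c))\<^sup>2)"
    using parseval[of "{..<n}" u] u by simp
  finally have trace: "(\<Sum>i<n. \<mu> i) = (\<Sum>c<m. \<Sum>x<n. (B $$ (x, c))\<^sup>2)" .
  have "(\<Sum>i<n. \<mu> i) = (\<Sum>i<min q n. \<mu> i) + (\<Sum>i\<in>{min q n..<n}. \<mu> i)"
    by (simp add: lessThan_atLeast0 sum.atLeastLessThan_concat)
  then have "(\<Sum>i = 1..q. eigval A i) = (\<Sum>c<m. \<Sum>x<n. (B $$ (x, c))\<^sup>2)
      \<longleftrightarrow> (\<Sum>i\<in>{min q n..<n}. \<mu> i) = 0"
    unfolding sum_eigval len trace[symmetric] by (auto simp: \<mu>_def)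
  also have "\<dots> \<longleftrightarrow> (\<forall>i\<in>{min q n..<n}. \<mu> i = 0)"
    using nonneg by (intro sum_nonneg_eq_0_iff) auto
  also have "\<dots> \<longleftrightarrow> mat_rank B \<le> q"
  proof
    assume "\<forall>i\<in>{min q n..<n}. \<mu> i = 0"
    then have "{i. i < n \<and> \<mu> i \<noteq> 0} \<subseteq> {..<q}" by (auto simp: not_le[symmetric])
    then show "mat_rank B \<le> q" unfolding rank using card_mono[of "{..<q}"] by simp
  next
    assume le: "mat_rank B \<le> q"
    show "\<forall>i\<in>{min q n..<n}. \<mu> i = 0"
    proof (rule ccontr)
      assume "\<not> (\<forall>i\<in>{min q n..<n}. \<mu> i = 0)"
      then obtain j where j: "q \<le> j" "j < n" "\<mu> j \<noteq> 0" by (auto simp: min_le_iff_disj)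
      have "\<mu> i \<noteq> 0" if "i \<le> j" for i using dec[OF that j(2)] nonneg[OF j(2)] j(3) by auto
      then have "{..j} \<subseteq> {i. i < n \<and> \<mu> i \<noteq> 0}" using j by auto
      then have "card {..j} \<le> mat_rank B" unfolding rank by (intro card_mono) auto
      then show False using le j by simp
    qed
  qed
  finally show ?thesis .
qed

lemma (in signed_incidence) sum_up_deg: "(\<Sum>\<tau>\<in>R. real (up_deg \<tau>)) = (\<Sum>F\<in>C. \<Sum>\<tau>\<in>R. (b F \<tau>)\<^sup>2)"
proof -
  have "(\<Sum>\<tau>\<in>R. real (up_deg \<tau>)) = (\<Sum>\<tau>\<in>R. \<Sum>F | F \<in> C \<and> \<tau> \<subseteq> F. 1)" by (simp add: up_deg_def)
  also have "\<dots> = (\<Sum>F\<in>C. \<Sum>\<tau> | \<tau> \<in> R \<and> \<tau> \<subseteq> F. 1)" by (rule sum.swap_restrict[OF finR finC])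
  also have "\<dots> = (\<Sum>F\<in>C. \<Sum>\<tau>\<in>R. (b F \<tau>)\<^sup>2)"
  proof (rule sum.cong[OF refl])
    fix F assume "F \<in> C"
    then show "(\<Sum>\<tau> | \<tau> \<in> R \<and> \<tau> \<subseteq> F. 1) = (\<Sum>\<tau>\<in>R. (b F \<tau>)\<^sup>2)"
      using card_facets[of F] sum_b_sq[of F] by simp
  qed
  finally show ?thesis .
qed

text \<open>For the signs at \<open>\<eta>\<close> one fixes an order \<open>e\<close> of its vertices and compares the orientation of
  \<open>insert x \<eta>\<close> with the order \<open>x # e\<close>.\<close>

lemma simplicial_signed_incidence:
  assumes X: "abstract_complex V X" and r: "r \<ge> 2" and ori: "orientation X ori"
  shows "signed_incidence (simplices X (r - 1)) (simplices X r) r (\<lambda>F \<tau>. real_of_int (incidence ori F \<tau>))"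
proof -
  have finX: "finite X" and fin: "\<And>\<sigma>. \<sigma> \<in> X \<Longrightarrow> finite \<sigma>"
    using X by (auto simp: abstract_complex_def intro: finite_subset)
  have down: "\<And>\<sigma> \<tau>. \<sigma> \<in> X \<Longrightarrow> \<tau> \<subseteq> \<sigma> \<Longrightarrow> \<tau> \<in> X" using X by (auto simp: abstract_complex_def)
  have o: "\<And>\<sigma>. \<sigma> \<in> X \<Longrightarrow> distinct (ori \<sigma>) \<and> set (ori \<sigma>) = \<sigma>" using ori by (auto simp: orientation_def)
  show ?thesis
  proof (standard, goal_cases)
    case 1 show ?case by fact
  next
    case 2 show ?case using finX by (simp add: simplices_def)
  next
    case 3 show ?case using finX by (simp add: simplices_def)
  next
    case (4 F) then show ?case using fin by (simp add: simplices_def)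
  next
    case (5 \<tau>) then show ?case using fin r by (simp add: simplices_def)
  next
    case (6 F \<tau>) then show ?case using down r by (auto simp: simplices_def)
  next
    case (7 F \<tau>)
    then have FX: "F \<in> X" "\<tau> \<in> X" "card F = Suc (card \<tau>)" using r by (auto simp: simplices_def)
    then have "card (F - \<tau>) = 1" using 7 fin by (simp add: card_Diff_subset)
    then obtain v where "F - \<tau> = {v}" by (auto simp: card_1_singleton_iff)
    then have "v \<in> F" "\<tau> = F - {v}" using 7 by auto
    then have "(incidence ori F \<tau>)\<^sup>2 = 1" using o[OF FX(1)] o[OF FX(2)] by (intro incidence_codim1(1)) auto
    then show ?case by (metis of_int_1 of_int_power)
  next
    case (8 F \<tau>)
    then show ?case using o[of F] o[of \<tau>] by (simp add: incidence_not_face simplices_def)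
  next
    case (9 \<eta>)
    show ?case
    proof (cases "card \<eta> = r - 1")
      case False
      then show ?thesis by (intro exI[of _ "\<lambda>_. 1"]) simp
    next
      case \<eta>: True
      then have fin\<eta>: "finite \<eta>" using r card.infinite by fastforce
      then obtain e where e: "set e = \<eta>" "distinct e" using finite_distinct_list by blast
      \<comment> \<open>The default value 1 makes \<open>\<sigma>\<close> a sign on every set.\<close>
      define \<sigma> where "\<sigma> \<tau> = (if \<tau> \<in> X \<and> (\<exists>x. x \<notin> \<eta> \<and> \<tau> = insert x \<eta>)
        then rel_sign (ori \<tau>) (the_elem (\<tau> - \<eta>) # e) else 1)" for \<tau>
      have \<sigma>: "\<sigma> (insert x \<eta>) = rel_sign (ori (insert x \<eta>)) (x # e)" if "x \<notin> \<eta>" "insert x \<eta> \<in> X" for x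
      proof -
        have "insert x \<eta> - \<eta> = {x}" using that by auto
        then show ?thesis using that by (auto simp: \<sigma>_def)
      qed
      have "(\<sigma> \<tau>)\<^sup>2 = 1" for \<tau>
      proof (cases "\<tau> \<in> X \<and> (\<exists>x. x \<notin> \<eta> \<and> \<tau> = insert x \<eta>)")
        case True
        then obtain x where x: "\<tau> \<in> X" "x \<notin> \<eta>" "\<tau> = insert x \<eta>" by blast
        then have "(rel_sign (ori \<tau>) (x # e))\<^sup>2 = 1"
          using o[OF x(1)] e by (intro rel_sign_square) auto
        then show ?thesis using \<sigma> x by simp
      next
        case False
        then show ?thesis unfolding \<sigma>_def by (simp only: if_False) simp
      qed
      moreover have "incidence ori F \<tau> * \<sigma> \<tau> + incidence ori F \<tau>' * \<sigma> \<tau>' = 0"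
        if F: "F \<in> simplices X r" and t: "\<tau> \<in> simplices X (r - 1)" "\<tau>' \<in> simplices X (r - 1)"
          "\<eta> \<subseteq> \<tau>" "\<eta> \<subseteq> \<tau>'" "\<tau> \<noteq> \<tau>'" "\<tau> \<subseteq> F" "\<tau>' \<subseteq> F" for F \<tau> \<tau>'
      proof -
        have ins: "\<exists>x. x \<notin> \<eta> \<and> \<tau> = insert x \<eta>" if "\<tau> \<in> simplices X (r - 1)" "\<eta> \<subseteq> \<tau>" for \<tau>
        proof -
          have "card (\<tau> - \<eta>) = 1"
            using that \<eta> r fin\<eta> by (simp add: card_Diff_subset simplices_def)
          then obtain x where "\<tau> - \<eta> = {x}" by (auto simp: card_1_singleton_iff)
          then show ?thesis using that by blast
        qed
        obtain x y where x: "x \<notin> \<eta>" "\<tau> = insert x \<eta>" and y: "y \<notin> \<eta>" "\<tau>' = insert y \<eta>"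
          using ins[OF t(1,3)] ins[OF t(2,4)] by blast
        have xy: "x \<noteq> y" using x y t by auto
        have "insert x (insert y \<eta>) \<subseteq> F" "card (insert x (insert y \<eta>)) = card F" "finite F"
          using x y xy t F fin\<eta> \<eta> r fin by (auto simp: simplices_def)
        then have Feq: "F = insert x (insert y \<eta>)" by (metis card_subset_eq)
        have mem: "F \<in> X" "insert x \<eta> \<in> X" "insert y \<eta> \<in> X" using F t x y by (auto simp: simplices_def)
        have "incidence ori F (insert x (set e)) * rel_sign (ori (insert x (set e))) (x # e)
          + incidence ori F (insert y (set e)) * rel_sign (ori (insert y (set e))) (y # e) = 0"
          by (rule boundary_square_zero) (use o mem e x y xy Feq in auto)
        then show ?thesis using \<sigma> x y mem e by simp
      qed
      ultimately show ?thesis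
        by (intro exI[of _ "\<lambda>\<tau>. real_of_int (\<sigma> \<tau>)"])
          (auto simp flip: of_int_power of_int_mult of_int_add simp del: of_int_0)
    qed
  qed
qed

theorem theorem1:
  fixes V :: "'a set" and X :: "'a set set" and r q :: nat
    and ori :: "'a set \<Rightarrow> 'a list" and rs cs :: "'a set list"
  assumes "abstract_complex V X"
    and "complex_dim X = int r"
    and "r \<ge> 2"
    and "q \<ge> 1"
    and "orientation X ori"
    and "enumerates rs (simplices X (r - 1))"
    and "enumerates cs (simplices X r)"
  shows "(\<Sum>i=1..q. eigval (up_laplacian ori rs cs) i) = real (\<Sum>i=1..q. conj_degree X (r - 1) i)
     \<longleftrightarrow> q \<ge> max (mat_rank (boundary_mat ori rs cs)) (max_degree X (r - 1))"
proof -
  define R where "R = simplices X (r - 1)"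
  define C where "C = simplices X r"
  define b where "b F \<tau> = real_of_int (incidence ori F \<tau>)" for F \<tau>
  interpret signed_incidence R C r b
    unfolding R_def C_def b_def by (rule simplicial_signed_incidence) fact+
  have rs: "distinct rs" "set rs = R" and cs: "distinct cs" "set cs = C"
    using assms(6,7) by (auto simp: enumerates_def R_def C_def)
  define n where "n = length rs"
  define m where "m = length cs"
  define B where "B = boundary_mat ori rs cs"
  define L where "L = B * transpose_mat B"
  have L: "up_laplacian ori rs cs = L" by (simp add: up_laplacian_def L_def B_def)
  have B: "B \<in> carrier_mat n m" by (simp add: B_def boundary_mat_def n_def m_def)
  have entry: "B $$ (x, c) = b (cs ! c) (rs ! x)" if "x < n" "c < m" for x c
    using that by (simp add: B_def boundary_mat_def n_def m_def b_def)
  have sumR: "(\<Sum>x<n. f (rs ! x)) = (\<Sum>\<tau>\<in>R. f \<tau>)" for f :: "'a set \<Rightarrow> real"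
    using sum_nth_eq_sum_set[OF rs(1), of f] rs(2) by (simp add: n_def)
  have sumC: "(\<Sum>c<m. f (cs ! c)) = (\<Sum>F\<in>C. f F)" for f :: "'a set \<Rightarrow> real"
    using sum_nth_eq_sum_set[OF cs(1), of f] cs(2) by (simp add: m_def)
  have degree: "simplex_degree X (r - 1) = up_deg"
    using assms(3) by (intro ext, unfold simplex_degree_def up_deg_def) (simp add: C_def)
  have conj: "(\<Sum>i=1..q. conj_degree X (r - 1) i) = (\<Sum>\<tau>\<in>R. min (up_deg \<tau>) q)"
    unfolding conj_degree_def degree R_def[symmetric] by (rule sum_card_levels_eq_sum_min[OF finR])
  have maxdeg: "max_degree X (r - 1) = Max (up_deg ` R)"
    unfolding max_degree_def degree R_def ..
  have "R \<noteq> {}"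
  proof -
    have X: "finite X" "X \<noteq> {}" using assms(1)
      by (auto simp: abstract_complex_def intro: finite_subset)
    have "complex_dim X \<in> (\<lambda>\<sigma>. int (card \<sigma>) - 1) ` X"
      unfolding complex_dim_def using X by (intro Max_in) auto
    then obtain F where "F \<in> X" "card F = r + 1" using assms(2) by auto
    then have "F \<in> C" by (simp add: C_def simplices_def)
    then have "card {\<tau> \<in> R. \<tau> \<subseteq> F} = r + 1" by (rule card_facets)
    then show ?thesis by auto
  qed
  show ?thesis
  proof (cases "Max (up_deg ` R) \<le> q")
    case True
    then have "up_deg \<tau> \<le> q" if "\<tau> \<in> R" for \<tau>
      using that finR by (meson Max_ge finite_imageI imageI order_trans)
    then have "real (\<Sum>\<tau>\<in>R. min (up_deg \<tau>) q) = (\<Sum>\<tau>\<in>R. real (up_deg \<tau>))"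
      by (simp add: min_absorb1)
    also have "\<dots> = (\<Sum>F\<in>C. \<Sum>\<tau>\<in>R. (b F \<tau>)\<^sup>2)" by (rule sum_up_deg)
    also have "\<dots> = (\<Sum>c<m. \<Sum>x<n. (B $$ (x, c))\<^sup>2)"
      by (simp add: entry sumR[of "\<lambda>\<tau>. (b _ \<tau>)\<^sup>2"] sumC[of "\<lambda>F. \<Sum>\<tau>\<in>R. (b F \<tau>)\<^sup>2"])
    finally have total: "real (\<Sum>\<tau>\<in>R. min (up_deg \<tau>) q) = (\<Sum>c<m. \<Sum>x<n. (B $$ (x, c))\<^sup>2)" .
    have "(\<Sum>i=1..q. eigval L i) = real (\<Sum>\<tau>\<in>R. min (up_deg \<tau>) q) \<longleftrightarrow> mat_rank B \<le> q"
      unfolding total L_def by (rule sum_first_eigvals_eq_trace_iff[OF B])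
    then show ?thesis using True unfolding L conj maxdeg B_def[symmetric] by simp
  next
    case False
    obtain \<tau>0 where t0: "\<tau>0 \<in> R" "up_deg \<tau>0 = Max (up_deg ` R)"
      using Max_in[of "up_deg ` R"] finR \<open>R \<noteq> {}\<close> by fastforce
    obtain u where len: "length (eigval_list L) = n" and u: "orthonormal_on {..<n} n u"
      and val: "\<And>i. i < n \<Longrightarrow> eigval_list L ! i = (\<Sum>c<m. (\<Sum>x<n. B $$ (x, c) * u i x)\<^sup>2)"
      using gram_eigen[OF B, folded L_def] by blast
    \<comment> \<open>The first eigenvectors, read as functions on simplices. Only \<open>min q n\<close> of them exist, and
      \<open>eigval\<close> is zero beyond.\<close>
    define w where "w i \<tau> = u i (inv_into {..<n} ((!) rs) \<tau>)" for i \<tau>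
    have "inj_on ((!) rs) {..<n}" using rs by (simp add: inj_on_def n_def nth_eq_iff_index_eq)
    then have w: "w i (rs ! x) = u i x" if "x < n" for i x
      using that by (simp add: w_def inv_into_f_f)
    define k where "k = min q n"
    have "orthonormal_on R k w"
    proof -
      have "(\<Sum>\<tau>\<in>R. w i \<tau> * w j \<tau>) = (\<Sum>x<n. u i x * u j x)" for i j
        unfolding sumR[symmetric] by (simp add: w)
      then show ?thesis using u by (simp add: orthonormal_on_def k_def)
    qed
    then have "(\<Sum>i<k. \<Sum>F\<in>C. (\<Sum>\<tau>\<in>R. b F \<tau> * w i \<tau>)\<^sup>2) < real (\<Sum>\<tau>\<in>R. min (up_deg \<tau>) q)"
      by (rule frame_sum_less[OF _ _ assms(4) t0(1)]) (use t0 False in \<open>auto simp: k_def\<close>)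
    moreover have "(\<Sum>i<k. \<Sum>F\<in>C. (\<Sum>\<tau>\<in>R. b F \<tau> * w i \<tau>)\<^sup>2) = (\<Sum>i=1..q. eigval L i)"
      unfolding sum_eigval len k_def[symmetric]
    proof (intro sum.cong refl)
      fix i assume "i \<in> {..<k}"
      then have i: "i < n" by (simp add: k_def)
      have "(\<Sum>F\<in>C. (\<Sum>\<tau>\<in>R. b F \<tau> * w i \<tau>)\<^sup>2) = (\<Sum>c<m. (\<Sum>x<n. b (cs ! c) (rs ! x) * w i (rs ! x))\<^sup>2)"
        unfolding sumC[symmetric] sumR[symmetric] ..
      then show "(\<Sum>F\<in>C. (\<Sum>\<tau>\<in>R. b F \<tau> * w i \<tau>)\<^sup>2) = eigval_list L ! i"
        unfolding val[OF i] by (simp add: w entry)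
    qed
    ultimately show ?thesis using False unfolding L conj maxdeg by simp
  qed
qed

end
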